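(* The following types of reduced properly embedded meromorphic ends of order $3$ can occur. Every end of type $(2,2,3)$ is properly embedded. For each of the types $(1,2,3)$, $(0,2,3)$ and $(0,1,3)$, there exist properly embedded ends of that type. Every other end of order $3$ is of one of the types $(2,3,3)$, $(1,3,3)$, $(0,3,3)$, $(0,0,3)$, and no end of any of these four types is properly embedded.
   Context: Let $\mathbb{D}^*=\{z\in\mathbb{C}: 0<|z|<1\}$. A meromorphic end is a harmonic map $f:\mathbb{D}^*\to\mathbb{R}^3$ of the form $f(z)=\operatorname{Re}\int^z(\omega_1,\omega_2,\omega_3)$, where $\omega_1,\omega_2,\omega_3$ are 1-forms holomorphic on $\mathbb{D}^*$ and meromorphic at $0$; since $f$ is single valued, the residues of the $\omega_k$ at $0$ are real. The pole order of a form holomorphic at $0$ is $0$. Two ends $f,\tilde f$ are affinely equivalent if $\tilde f=A\circ f$ for an invertible real affine map $A:\mathbb{R}^3\to\mathbb{R}^3$. An end is in reduced form if the pole orders $n_k$ of $\omega_k$ at $0$ satisfy $n_1\le n_2\le n_3$ and $(n_1,n_2,n_3)$ is lexicographically minimal among all affinely equivalent ends. The type of an end is the tuple $(n_1,n_2,n_3)$ of an affinely equivalent end in reduced form, and $n_3$ is the order of the end. An end is proper if $|f(z)|\to\infty$ as $z\to 0$; it is properly embedded if it is proper and its restriction to a sufficiently small punctured disk around $0$ is an injective immersion. *)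

theory Defs
  imports "HOL-Complex_Analysis.Complex_Analysis"
begin

definition punctured_disk :: "real \<Rightarrow> complex set" where
  "punctured_disk r = ball 0 r - {0}"

text \<open>A form on the punctured unit disk is written \<open>\<phi>(z) dz\<close> and represented by its coefficient \<open>\<phi>\<close>;
  the three coefficients are the components of a map into \<open>complex ^ 3\<close>. Maps defined on the punctured
  unit disk are total functions whose values outside it (in particular at \<open>0\<close>) play no role.\<close>

definition meromorphic_forms :: "(complex \<Rightarrow> complex ^ 3) \<Rightarrow> bool" where
  "meromorphic_forms \<phi> \<longleftrightarrow>
     (\<forall>k. (\<lambda>z. \<phi> z $ k) holomorphic_on punctured_disk 1 \<and>
          (\<lambda>z. \<phi> z $ k) meromorphic_on {0})"

text \<open>\<open>f = Re \<integral> \<phi> dz\<close> up to an additive constant. Quantifying over all paths makes the real parts of the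
  periods vanish (so the residues are real) and makes \<open>f\<close> harmonic; it also determines \<open>\<phi>\<close>
  uniquely on the punctured unit disk.\<close>

definition is_real_integral :: "(complex \<Rightarrow> real ^ 3) \<Rightarrow> (complex \<Rightarrow> complex ^ 3) \<Rightarrow> bool" where
  "is_real_integral f \<phi> \<longleftrightarrow>
     (\<forall>\<gamma> k. valid_path \<gamma> \<and> path_image \<gamma> \<subseteq> punctured_disk 1 \<longrightarrow>
        f (pathfinish \<gamma>) $ k - f (pathstart \<gamma>) $ k = Re (contour_integral \<gamma> (\<lambda>z. \<phi> z $ k)))"

definition end_with_forms :: "(complex \<Rightarrow> real ^ 3) \<Rightarrow> (complex \<Rightarrow> complex ^ 3) \<Rightarrow> bool" where
  "end_with_forms f \<phi> \<longleftrightarrow> meromorphic_forms \<phi> \<and> is_real_integral f \<phi>"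

definition meromorphic_end :: "(complex \<Rightarrow> real ^ 3) \<Rightarrow> bool" where
  "meromorphic_end f \<longleftrightarrow> (\<exists>\<phi>. end_with_forms f \<phi>)"

text \<open>The case distinction covers removable singularities, including the zero form, for which
  \<^const>\<open>zorder\<close> is unspecified.\<close>

definition pole_order :: "(complex \<Rightarrow> complex) \<Rightarrow> nat" where
  "pole_order g = (if is_pole g 0 then nat (- zorder g 0) else 0)"

definition has_pole_orders :: "(complex \<Rightarrow> real ^ 3) \<Rightarrow> nat \<times> nat \<times> nat \<Rightarrow> bool" where
  "has_pole_orders f n \<longleftrightarrow>
     (\<exists>\<phi>. end_with_forms f \<phi> \<and>
          n = (pole_order (\<lambda>z. \<phi> z $ 1), pole_order (\<lambda>z. \<phi> z $ 2), pole_order (\<lambda>z. \<phi> z $ 3)))"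

definition affinely_equivalent :: "(complex \<Rightarrow> real ^ 3) \<Rightarrow> (complex \<Rightarrow> real ^ 3) \<Rightarrow> bool" where
  "affinely_equivalent f g \<longleftrightarrow>
     (\<exists>(M :: real ^ 3 ^ 3) b. invertible M \<and> (\<forall>z\<in>punctured_disk 1. g z = M *v f z + b))"

definition lex_less :: "((nat \<times> nat \<times> nat) \<times> (nat \<times> nat \<times> nat)) set" where
  "lex_less = less_than <*lex*> less_than <*lex*> less_than"

definition reduced_with_orders :: "(complex \<Rightarrow> real ^ 3) \<Rightarrow> nat \<times> nat \<times> nat \<Rightarrow> bool" where
  "reduced_with_orders f n \<longleftrightarrow>
     has_pole_orders f n \<and>
     (case n of (n1, n2, n3) \<Rightarrow> n1 \<le> n2 \<and> n2 \<le> n3) \<and>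
     (\<forall>g m. affinely_equivalent f g \<and> has_pole_orders g m \<longrightarrow> (m, n) \<notin> lex_less)"

definition has_type :: "(complex \<Rightarrow> real ^ 3) \<Rightarrow> nat \<times> nat \<times> nat \<Rightarrow> bool" where
  "has_type f n \<longleftrightarrow> (\<exists>g. affinely_equivalent f g \<and> reduced_with_orders g n)"

definition has_order :: "(complex \<Rightarrow> real ^ 3) \<Rightarrow> nat \<Rightarrow> bool" where
  "has_order f n3 \<longleftrightarrow> (\<exists>n1 n2. has_type f (n1, n2, n3))"

definition proper_end :: "(complex \<Rightarrow> real ^ 3) \<Rightarrow> bool" where
  "proper_end f \<longleftrightarrow> filterlim (\<lambda>z. norm (f z)) at_top (at 0)"

definition immersion_on :: "(complex \<Rightarrow> real ^ 3) \<Rightarrow> complex set \<Rightarrow> bool" where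
  "immersion_on f S \<longleftrightarrow> (\<forall>z\<in>S. \<exists>f'. (f has_derivative f') (at z) \<and> inj f')"

definition properly_embedded :: "(complex \<Rightarrow> real ^ 3) \<Rightarrow> bool" where
  "properly_embedded f \<longleftrightarrow>
     proper_end f \<and>
     (\<exists>r. 0 < r \<and> r \<le> 1 \<and> inj_on f (punctured_disk r) \<and> immersion_on f (punctured_disk r))"

end

theory Submission imports Defs begin

text \<open>
  Near \<open>0\<close> each component of an end of order at most 3 is
  \<open>Re (- a / (2 z\<^sup>2) - b / z + H z) + c ln |z|\<close>. In reduced form, coordinates with equal
  pole order have leading coefficients that are linearly independent over the reals, which excludes the
  types \<open>(3,3,3)\<close> and, since residues are real, \<open>(1,1,3)\<close>.

  For type \<open>(2,2,3)\<close> the first two coordinates are already an embedding into the plane: in the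
  variable \<open>1 / z\<close> they are a linear isomorphism plus a term with a small Lipschitz constant.
  If the last two pole orders are 3, the last two coordinates can be normalised to
  \<open>G z = 1 / z\<^sup>2 + O(1 / |z|)\<close>, which has a square root \<open>1 / t\<close> with \<open>t\<close> a homeomorphism
  near \<open>0\<close>. So \<open>G\<close> identifies opposite points of a small circle in the \<open>t\<close>-plane, and by
  the intermediate value theorem the remaining coordinate agrees at some such pair. For type \<open>(0,0,3)\<close> the only
  unbounded coordinate changes sign on every small circle, so the end is not proper.
\<close>

text \<open>Two coordinates combine into a planar map that need not be holomorphic: they are real
  parts of unrelated primitives and may carry logarithms, so complex inverse functions and conformal
  coordinates do not apply. The estimates are therefore Lipschitz estimates in the variable
  \<open>1 / z\<close>. There a double pole of a form becomes a linear map, while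
  \<open>ln (norm z)\<close> and the regular part have Lipschitz constant O(r) on the disk of radius
  r. The coordinate \<open>t\<close> is obtained as a small Lipschitz perturbation of the identity,
  and invariance of domain makes it a homeomorphism.

  Lexicographic minimality quantifies over all affine images. Against a given end it is exploited by
  exhibiting one matrix that lowers an entry; for an example it is certified by the pole orders of
  all real combinations of its forms. The geometric statements are proved for a reduced
  representative and transferred by affine invariance. The ends of types (1,2,3), (0,2,3) and
  (0,1,3) are explicit enough to be injective on the whole punctured unit disk: \<open>1 / z\<close>
  is recovered from the coordinates.\<close>

no_notation fps_nth (infixl "$" 75)

section \<open>Forms with a pole of order at most three\<close>

lemma punctured_disk_iff: "z \<in> punctured_disk r \<longleftrightarrow> norm z < r \<and> z \<noteq> 0"
  by (auto simp: punctured_disk_def)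

lemma open_punctured_disk: "open (punctured_disk r)"
  by (simp add: punctured_disk_def open_delete)

lemma connected_punctured_disk: "connected (punctured_disk r)"
  unfolding punctured_disk_def by (rule connected_open_delete) auto

lemma eventually_punctured_disk:
  assumes "r > 0" shows "eventually (\<lambda>z. z \<in> punctured_disk r) (at 0)"
  unfolding punctured_disk_def by (rule eventually_at_in_open) (use assms in auto)

lemma holomorphic_ball_tendsto_0:
  assumes "p holomorphic_on ball 0 r" "r > 0"
  shows "p \<midarrow>0\<rightarrow> p 0"
  using holomorphic_on_imp_continuous_on[OF assms(1)] assms(2)
  by (simp add: continuous_on_eq_continuous_at isContD)

text \<open>Any of \<open>a\<close>, \<open>b\<close>, \<open>c\<close> may vanish, so one format
  serves all pole orders up to 3. The remainder \<open>h\<close> lives on the whole unit ball, not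
  just near 0, so that it has a primitive there; the equation is asked only off 0 since
  \<open>g 0\<close> carries no information.\<close>

definition cubic_pole_form ::
    "(complex \<Rightarrow> complex) \<Rightarrow> complex \<Rightarrow> complex \<Rightarrow> complex \<Rightarrow> (complex \<Rightarrow> complex) \<Rightarrow> bool" where
  "cubic_pole_form g a b c h \<longleftrightarrow> h holomorphic_on ball 0 1 \<and>
     (\<forall>z\<in>punctured_disk 1. g z = a / z ^ 3 + b / z ^ 2 + c / z + h z)"

lemma pole_order_cong:
  assumes "\<And>z. z \<in> punctured_disk 1 \<Longrightarrow> f z = g z"
  shows "pole_order f = pole_order g"
proof -
  have "eventually (\<lambda>z. f z = g z) (at 0)"
    using eventually_punctured_disk[of 1] by (rule eventually_mono) (use assms in auto)
  then show ?thesis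
    unfolding pole_order_def using is_pole_cong[of f g 0 0] zorder_cong[of f g 0 0] by auto
qed

lemma pole_order_eqI:
  assumes p: "p holomorphic_on ball 0 1" "p 0 \<noteq> 0"
    and eq: "\<And>z. z \<in> punctured_disk 1 \<Longrightarrow> g z = p z / z ^ n"
  shows "pole_order g = n"
proof -
  have tend: "p \<midarrow>0\<rightarrow> p 0"
    using holomorphic_ball_tendsto_0[OF p(1)] by simp
  have ev: "eventually (\<lambda>z. g z = p z / z ^ n) (at 0)"
    using eventually_punctured_disk[of 1] by (rule eventually_mono) (use eq in auto)
  show ?thesis
  proof (cases "n = 0")
    case True
    have "g \<midarrow>0\<rightarrow> p 0"
      using tend ev True by (simp add: tendsto_cong)
    then have "\<not> is_pole g 0"
      unfolding is_pole_def using not_tendsto_and_filterlim_at_infinity[of "at (0::complex)" g] by auto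
    then show ?thesis using True by (simp add: pole_order_def)
  next
    case False
    have "is_pole (\<lambda>z. p z / z ^ n) 0"
    proof -
      have "filterlim (\<lambda>z::complex. z ^ n) (at 0) (at 0)"
        using False by (auto simp: filterlim_at eventually_at intro!: tendsto_eq_intros exI[of _ 1])
      then show ?thesis
        unfolding is_pole_def by (intro filterlim_divide_at_infinity[OF tend]) (use p in auto)
    qed
    then have pole: "is_pole g 0" using is_pole_cong[OF ev refl] by simp
    have "zorder g 0 = - int n"
    proof (rule zorder_eqI[of "ball 0 1" _ p])
      fix w :: complex assume "w \<in> ball 0 1" "w \<noteq> 0"
      then show "g w = p w * (w - 0) powi - int n"
        using eq[of w] by (simp add: punctured_disk_def power_int_minus divide_inverse)
    qed (use p in auto)
    then show ?thesis using pole by (simp add: pole_order_def)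
  qed
qed

lemma cubic_pole_form_imp_holomorphic:
  assumes "cubic_pole_form g a b c h"
  shows "g holomorphic_on punctured_disk 1"
proof -
  have "(\<lambda>z. a / z ^ 3 + b / z ^ 2 + c / z + h z) holomorphic_on punctured_disk 1"
    using assms unfolding cubic_pole_form_def
    by (intro holomorphic_intros) (auto simp: punctured_disk_def intro: holomorphic_on_subset)
  then show ?thesis
    using assms unfolding cubic_pole_form_def by (metis (no_types, lifting) holomorphic_transform)
qed

lemma cubic_pole_form_imp_meromorphic:
  assumes "cubic_pole_form g a b c h"
  shows "g meromorphic_on {0}"
proof -
  have "h analytic_on ball 0 1" using assms by (simp add: cubic_pole_form_def analytic_on_open)
  then have "h meromorphic_on {0}"
    by (meson analytic_on_imp_meromorphic_on analytic_on_subset centre_in_ball empty_subsetI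
        insert_subset zero_less_one)
  then have "(\<lambda>z. a / z ^ 3 + b / z ^ 2 + c / z + h z) meromorphic_on {0}"
    by (intro meromorphic_intros)
  moreover have "eventually (\<lambda>z. g z = a / z ^ 3 + b / z ^ 2 + c / z + h z) (at 0)"
    using eventually_punctured_disk[of 1]
    by (rule eventually_mono) (use assms in \<open>auto simp: cubic_pole_form_def\<close>)
  ultimately show ?thesis
    using meromorphic_on_cong[of "{0}" g "\<lambda>z. a / z ^ 3 + b / z ^ 2 + c / z + h z" "{0}"] by auto
qed

lemma pole_order_cubic_pole_form:
  assumes "cubic_pole_form g a b c h"
  shows "pole_order g = (if a \<noteq> 0 then 3 else if b \<noteq> 0 then 2 else if c \<noteq> 0 then 1 else 0)"
proof -
  have h: "h holomorphic_on ball 0 1"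
    and eq: "\<And>z. z \<in> punctured_disk 1 \<Longrightarrow> g z = a / z ^ 3 + b / z ^ 2 + c / z + h z"
    using assms by (auto simp: cubic_pole_form_def)
  consider "a \<noteq> 0" | "a = 0" "b \<noteq> 0" | "a = 0" "b = 0" "c \<noteq> 0" | "a = 0" "b = 0" "c = 0" by blast
  then show ?thesis
  proof cases
    case 1
    have "pole_order g = 3"
      by (rule pole_order_eqI[where p = "\<lambda>z. a + b * z + c * z ^ 2 + h z * z ^ 3"])
        (use 1 h eq in \<open>auto intro!: holomorphic_intros simp: field_simps punctured_disk_iff
          power2_eq_square power3_eq_cube\<close>)
    then show ?thesis using 1 by simp
  next
    case 2
    have "pole_order g = 2"
      by (rule pole_order_eqI[where p = "\<lambda>z. b + c * z + h z * z ^ 2"])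
        (use 2 h eq in \<open>auto intro!: holomorphic_intros simp: field_simps punctured_disk_iff
          power2_eq_square\<close>)
    then show ?thesis using 2 by simp
  next
    case 3
    have "pole_order g = 1"
      by (rule pole_order_eqI[where p = "\<lambda>z. c + h z * z"])
        (use 3 h eq in \<open>auto intro!: holomorphic_intros simp: field_simps punctured_disk_iff\<close>)
    then show ?thesis using 3 by simp
  next
    case 4
    have "h \<midarrow>0\<rightarrow> h 0"
      using holomorphic_ball_tendsto_0[OF h] by simp
    moreover have "eventually (\<lambda>z. h z = g z) (at 0)"
      using eventually_punctured_disk[of 1] by (rule eventually_mono) (use eq 4 in auto)
    ultimately have "g \<midarrow>0\<rightarrow> h 0" by (rule Lim_transform_eventually)
    then have "\<not> is_pole g 0"
      unfolding is_pole_def using not_tendsto_and_filterlim_at_infinity[of "at (0::complex)" g] by auto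
    then show ?thesis using 4 by (simp add: pole_order_def)
  qed
qed

lemma holomorphic_split_constant:
  assumes "p holomorphic_on ball 0 1"
  obtains q where "q holomorphic_on ball 0 1" "\<And>z. p z = p 0 + z * q z"
proof
  let ?q = "\<lambda>z. if z = 0 then deriv p 0 else (p z - p 0) / (z - 0)"
  show "?q holomorphic_on ball 0 1" using assms by (intro pole_lemma) auto
  show "p z = p 0 + z * ?q z" for z by auto
qed

text \<open>\<open>z ^ 3 * g z\<close> has a limit at 0 because the pole order is at most 3, hence
  it extends holomorphically to the unit ball. Splitting off the value at 0 three times produces the
  principal part and the remainder.\<close>

lemma cubic_pole_form_exists:
  assumes hol: "g holomorphic_on punctured_disk 1" and mero: "g meromorphic_on {0}"
    and ord: "pole_order g \<le> 3"
  obtains a b c h where "cubic_pole_form g a b c h"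
proof -
  have ness: "isolated_singularity_at g 0" "not_essential g 0"
    using mero by (simp_all add: meromorphic_at_iff)
  have "\<exists>L. (\<lambda>z. z ^ 3 * g z) \<midarrow>0\<rightarrow> L"
  proof (cases "is_pole g 0")
    case True
    define n where "n = zorder g 0"
    define P where "P = zor_poly g 0"
    have "n \<ge> -3" using ord True by (simp add: pole_order_def n_def)
    have fr: "\<exists>\<^sub>F w in at 0. g w \<noteq> 0"
      using non_zero_neighbour_pole[OF True] by (intro eventually_frequently) auto
    obtain r where r: "r > 0" "P holomorphic_on cball 0 r"
        "\<And>w. w \<in> cball 0 r - {0} \<Longrightarrow> g w = P w * (w - 0) powi n \<and> P w \<noteq> 0"
      using zorder_exist[OF ness fr] unfolding n_def P_def by blast
    have "P \<midarrow>0\<rightarrow> P 0"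
      using holomorphic_ball_tendsto_0[of P r] r(1,2) ball_subset_cball holomorphic_on_subset by blast
    then have "(\<lambda>z. P z * z ^ nat (n + 3)) \<midarrow>0\<rightarrow> P 0 * 0 ^ nat (n + 3)"
      by (intro tendsto_intros)
    moreover have "eventually (\<lambda>z. P z * z ^ nat (n + 3) = z ^ 3 * g z) (at 0)"
      using eventually_punctured_disk[OF r(1)]
    proof (rule eventually_mono)
      fix z assume z: "z \<in> punctured_disk r"
      then have z0: "z \<noteq> 0" by (simp add: punctured_disk_iff)
      have "z ^ nat (n + 3) = z powi (n + 3)" using \<open>n \<ge> -3\<close> by (simp add: power_int_def)
      also have "\<dots> = z powi n * z ^ 3" using z0 by (simp add: power_int_add)
      finally show "P z * z ^ nat (n + 3) = z ^ 3 * g z"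
        using r(3)[of z] z by (simp add: punctured_disk_iff)
    qed
    ultimately show ?thesis by (blast intro: Lim_transform_eventually)
  next
    case False
    then obtain L where "g \<midarrow>0\<rightarrow> L" using ness by (auto simp: not_essential_def)
    then have "(\<lambda>z. z ^ 3 * g z) \<midarrow>0\<rightarrow> 0 ^ 3 * L" by (intro tendsto_intros)
    then show ?thesis by blast
  qed
  then obtain L where L: "(\<lambda>z. z ^ 3 * g z) \<midarrow>0\<rightarrow> L" by blast
  define p where "p = (\<lambda>z. if z = 0 then L else z ^ 3 * g z)"
  have "p holomorphic_on ball 0 1"
    unfolding p_def
    by (rule removable_singularity) (use hol L in \<open>auto intro!: holomorphic_intros simp: punctured_disk_def\<close>)
  then obtain q where q: "q holomorphic_on ball 0 1" "\<And>z. p z = p 0 + z * q z"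
    using holomorphic_split_constant by blast
  obtain q' where q': "q' holomorphic_on ball 0 1" "\<And>z. q z = q 0 + z * q' z"
    using holomorphic_split_constant[OF q(1)] by blast
  obtain h where h: "h holomorphic_on ball 0 1" "\<And>z. q' z = q' 0 + z * h z"
    using holomorphic_split_constant[OF q'(1)] by blast
  have "cubic_pole_form g (p 0) (q 0) (q' 0) h"
    unfolding cubic_pole_form_def
  proof (intro conjI ballI h)
    fix z assume "z \<in> punctured_disk 1"
    then have z: "z \<noteq> 0" by (simp add: punctured_disk_iff)
    have "z ^ 3 * g z = p z" using z by (simp add: p_def)
    also have "\<dots> = p 0 + z * (q 0 + z * (q' 0 + z * h z))"
      using q(2)[of z] q'(2)[of z] h(2)[of z] by simp
    finally have "g z = (p 0 + z * (q 0 + z * (q' 0 + z * h z))) / z ^ 3"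
      using z by (simp add: field_simps)
    also have "\<dots> = p 0 / z ^ 3 + q 0 / z ^ 2 + q' 0 / z + h z"
      using z by (simp add: field_simps power2_eq_square power3_eq_cube)
    finally show "g z = p 0 / z ^ 3 + q 0 / z ^ 2 + q' 0 / z + h z" .
  qed
  then show ?thesis using that by blast
qed

section \<open>Real potentials of cubic pole forms\<close>

text \<open>The real part of a primitive of a \<open>cubic_pole_form\<close>, with \<open>H\<close>
  a primitive of \<open>h\<close>. The residue term integrates to \<open>c\<close> times a branch of
  the logarithm, whose real part \<open>c * ln (norm z)\<close> is single valued because
  \<open>c\<close> is real.\<close>

definition cubic_potential ::
    "complex \<Rightarrow> complex \<Rightarrow> real \<Rightarrow> (complex \<Rightarrow> complex) \<Rightarrow> complex \<Rightarrow> real" where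
  "cubic_potential a b c H z = Re (- a / (2 * z ^ 2) - b / z + H z) + c * ln (norm z)"

text \<open>There is no primitive of \<open>1 / z\<close> on the punctured disk, so the integral is
  reached through the winding number: its exponential is the quotient of the end points, also for
  paths that are not closed.\<close>

lemma Re_contour_integral_inverse:
  assumes "valid_path \<gamma>" "0 \<notin> path_image \<gamma>"
  shows "Re (contour_integral \<gamma> (\<lambda>z. 1 / z)) = ln (norm (pathfinish \<gamma>)) - ln (norm (pathstart \<gamma>))"
proof -
  let ?I = "contour_integral \<gamma> (\<lambda>z. 1 / z)"
  have nz: "pathstart \<gamma> \<noteq> 0" "pathfinish \<gamma> \<noteq> 0"
    using assms(2) pathstart_in_path_image[of \<gamma>] pathfinish_in_path_image[of \<gamma>] by auto
  have "2 * pi * \<i> * winding_number \<gamma> 0 = ?I"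
    using winding_number_valid_path[OF assms] by simp
  then have "pathfinish \<gamma> = exp ?I * pathstart \<gamma>"
    using winding_number_exp_2pi[of \<gamma> 0] assms by (simp add: valid_path_imp_path)
  then have "norm (pathfinish \<gamma>) = exp (Re ?I) * norm (pathstart \<gamma>)"
    by (metis norm_exp_eq_Re norm_mult)
  then have "ln (norm (pathfinish \<gamma>)) = Re ?I + ln (norm (pathstart \<gamma>))"
    using nz by (simp add: ln_mult)
  then show ?thesis by simp
qed

lemma cubic_contour_integral:
  assumes g: "cubic_pole_form g a b c h"
    and H: "\<And>z. z \<in> ball 0 1 \<Longrightarrow> (H has_field_derivative h z) (at z)"
    and \<gamma>: "valid_path \<gamma>" "path_image \<gamma> \<subseteq> punctured_disk 1"
  shows "contour_integral \<gamma> g =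
     (- a / (2 * pathfinish \<gamma> ^ 2) - b / pathfinish \<gamma> + H (pathfinish \<gamma>)) -
     (- a / (2 * pathstart \<gamma> ^ 2) - b / pathstart \<gamma> + H (pathstart \<gamma>)) +
     c * contour_integral \<gamma> (\<lambda>z. 1 / z)"
proof -
  let ?P = "\<lambda>z. - a / (2 * z ^ 2) - b / z + H z"
  have 1: "((\<lambda>z. a / z ^ 3 + b / z ^ 2 + h z) has_contour_integral (?P (pathfinish \<gamma>) - ?P (pathstart \<gamma>))) \<gamma>"
  proof (rule contour_integral_primitive[of "punctured_disk 1"])
    fix z assume z: "z \<in> punctured_disk 1"
    then have "z \<noteq> 0" "(H has_field_derivative h z) (at z)" using H[of z] by (auto simp: punctured_disk_def)
    then have "(?P has_field_derivative a / z ^ 3 + b / z ^ 2 + h z) (at z)"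
      by (auto intro!: derivative_eq_intros simp: field_simps power2_eq_square power3_eq_cube)
    then show "(?P has_field_derivative a / z ^ 3 + b / z ^ 2 + h z) (at z within punctured_disk 1)"
      by (rule has_field_derivative_at_within)
  qed (use \<gamma> in auto)
  have "(\<lambda>z. 1 / z) contour_integrable_on \<gamma>"
    by (rule contour_integrable_holomorphic_simple[of _ "punctured_disk 1"])
      (use \<gamma> open_punctured_disk in \<open>auto intro!: holomorphic_intros simp: punctured_disk_def\<close>)
  then have 2: "((\<lambda>z. 1 / z) has_contour_integral contour_integral \<gamma> (\<lambda>z. 1 / z)) \<gamma>"
    by (rule has_contour_integral_integral)
  have "((\<lambda>z. (a / z ^ 3 + b / z ^ 2 + h z) + c * (1 / z)) has_contour_integral
      (?P (pathfinish \<gamma>) - ?P (pathstart \<gamma>)) + c * contour_integral \<gamma> (\<lambda>z. 1 / z)) \<gamma>"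
    by (intro has_contour_integral_add has_contour_integral_lmul 1 2)
  then have "(g has_contour_integral
      (?P (pathfinish \<gamma>) - ?P (pathstart \<gamma>)) + c * contour_integral \<gamma> (\<lambda>z. 1 / z)) \<gamma>"
    by (rule has_contour_integral_eq) (use g \<gamma>(2) in \<open>auto simp: cubic_pole_form_def\<close>)
  then show ?thesis by (simp add: contour_integral_unique)
qed

lemma Re_cubic_contour_integral:
  assumes g: "cubic_pole_form g a b (of_real c) h"
    and H: "\<And>z. z \<in> ball 0 1 \<Longrightarrow> (H has_field_derivative h z) (at z)"
    and \<gamma>: "valid_path \<gamma>" "path_image \<gamma> \<subseteq> punctured_disk 1"
  shows "Re (contour_integral \<gamma> g) =
    cubic_potential a b c H (pathfinish \<gamma>) - cubic_potential a b c H (pathstart \<gamma>)"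
proof -
  have "0 \<notin> path_image \<gamma>" using \<gamma>(2) by (auto simp: punctured_disk_def)
  then show ?thesis
    using arg_cong[OF cubic_contour_integral[OF assms], of Re]
    by (simp add: cubic_potential_def Re_contour_integral_inverse[OF \<gamma>(1)] right_diff_distrib)
qed

lemma holomorphic_ball_primitive:
  assumes "h holomorphic_on ball 0 1"
  obtains H where "\<And>z::complex. z \<in> ball 0 1 \<Longrightarrow> (H has_field_derivative h z) (at z)"
  using holomorphic_convex_primitive'[of "ball 0 1" h] assms
  by (auto simp: at_within_open_NO_MATCH)

text \<open>Over a circle around 0 only the residue term contributes, giving
  \<open>2 * pi * \<i> * c\<close>; its real part vanishes since the path is closed, hence
  \<open>Im c = 0\<close>.\<close>

lemma cubic_end_residue_real:
  assumes f: "is_real_integral f \<phi>" and g: "cubic_pole_form (\<lambda>z. \<phi> z $ k) a b c h"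
  shows "c \<in> \<real>"
proof -
  obtain H where H: "\<And>z. z \<in> ball 0 1 \<Longrightarrow> (H has_field_derivative h z) (at z)"
    using g holomorphic_ball_primitive unfolding cubic_pole_form_def by blast
  let ?\<gamma> = "circlepath 0 (1/2)"
  have im: "path_image ?\<gamma> \<subseteq> punctured_disk 1"
    by (auto simp: punctured_disk_iff)
  have I: "contour_integral ?\<gamma> (\<lambda>z. 1 / z) = 2 * pi * \<i>"
    using winding_number_valid_path[of ?\<gamma> 0] winding_number_circlepath_centre[of "1/2" 0] by simp
  have "0 = Re (contour_integral ?\<gamma> (\<lambda>z. \<phi> z $ k))"
    using f im unfolding is_real_integral_def by (metis cancel_comm_monoid_add_class.diff_cancel
        pathfinish_circlepath pathstart_circlepath valid_path_circlepath)
  also have "\<dots> = Re (c * (2 * pi * \<i>))"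
    using cubic_contour_integral[OF g H _ im] by (simp add: I)
  finally have "Im c = 0" by simp
  then show ?thesis by (simp add: complex_is_Real_iff)
qed

text \<open>Integration along a path from the base point 1/2 determines \<open>f\<close> up to a
  constant. This constant is absorbed into \<open>H\<close>, so the final equation is exact.\<close>

lemma cubic_end_component:
  assumes f: "end_with_forms f \<phi>" and ord: "pole_order (\<lambda>z. \<phi> z $ k) \<le> 3"
  obtains a b c h H where "cubic_pole_form (\<lambda>z. \<phi> z $ k) a b (of_real c) h"
    "\<And>z. z \<in> ball 0 1 \<Longrightarrow> (H has_field_derivative h z) (at z)"
    "\<And>z. z \<in> punctured_disk 1 \<Longrightarrow> f z $ k = cubic_potential a b c H z"
proof -
  have f': "is_real_integral f \<phi>" "(\<lambda>z. \<phi> z $ k) holomorphic_on punctured_disk 1"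
      "(\<lambda>z. \<phi> z $ k) meromorphic_on {0}"
    using f by (auto simp: end_with_forms_def meromorphic_forms_def)
  obtain a b c h where g: "cubic_pole_form (\<lambda>z. \<phi> z $ k) a b c h"
    using cubic_pole_form_exists[OF f'(2,3) ord] by blast
  obtain c' where c: "c = of_real c'" using cubic_end_residue_real[OF f'(1) g] by (auto elim: Reals_cases)
  note g = g[unfolded c]
  obtain H where H: "\<And>z. z \<in> ball 0 1 \<Longrightarrow> (H has_field_derivative h z) (at z)"
    using g holomorphic_ball_primitive unfolding cubic_pole_form_def by blast
  define z0 :: complex where "z0 = 1/2"
  define C where "C = f z0 $ k - cubic_potential a b c' H z0"
  have "f z $ k = cubic_potential a b c' (\<lambda>z. H z + of_real C) z" if z: "z \<in> punctured_disk 1" for z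
  proof -
    have "z0 \<in> punctured_disk 1" by (simp add: z0_def punctured_disk_iff)
    then obtain \<gamma> where \<gamma>: "polynomial_function \<gamma>" "path_image \<gamma> \<subseteq> punctured_disk 1"
        "pathstart \<gamma> = z0" "pathfinish \<gamma> = z"
      using connected_open_polynomial_connected[OF open_punctured_disk connected_punctured_disk] z by blast
    have v: "valid_path \<gamma>" using \<gamma>(1) by (rule valid_path_polynomial_function)
    have "f z $ k - f z0 $ k = Re (contour_integral \<gamma> (\<lambda>z. \<phi> z $ k))"
      using f'(1) v \<gamma> unfolding is_real_integral_def by metis
    also have "\<dots> = cubic_potential a b c' H z - cubic_potential a b c' H z0"
      using Re_cubic_contour_integral[OF g H v \<gamma>(2)] \<gamma> by simp
    finally show ?thesis by (simp add: C_def cubic_potential_def)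
  qed
  moreover have "((\<lambda>z. H z + of_real C) has_field_derivative h z) (at z)" if "z \<in> ball 0 1" for z
    using H[OF that] by (auto intro!: derivative_eq_intros)
  ultimately show ?thesis using that g by blast
qed

lemma cubic_end_with_formsI:
  assumes "\<And>k. \<exists>a b c h H. cubic_pole_form (\<lambda>z. \<phi> z $ k) a b (of_real c) h \<and>
      (\<forall>z\<in>ball 0 1. (H has_field_derivative h z) (at z)) \<and>
      (\<forall>z\<in>punctured_disk 1. f z $ k = cubic_potential a b c H z)"
  shows "end_with_forms f \<phi>"
  unfolding end_with_forms_def meromorphic_forms_def is_real_integral_def
proof (intro conjI allI impI)
  fix k
  obtain a b c h H where g: "cubic_pole_form (\<lambda>z. \<phi> z $ k) a b (of_real c) h"
      and H: "\<And>z. z \<in> ball 0 1 \<Longrightarrow> (H has_field_derivative h z) (at z)"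
      and f: "\<And>z. z \<in> punctured_disk 1 \<Longrightarrow> f z $ k = cubic_potential a b c H z"
    using assms[of k] by blast
  show "(\<lambda>z. \<phi> z $ k) holomorphic_on punctured_disk 1" "(\<lambda>z. \<phi> z $ k) meromorphic_on {0}"
    using g by (rule cubic_pole_form_imp_holomorphic cubic_pole_form_imp_meromorphic)+
  fix \<gamma> assume \<gamma>: "valid_path \<gamma> \<and> path_image \<gamma> \<subseteq> punctured_disk 1"
  then have "pathstart \<gamma> \<in> punctured_disk 1" "pathfinish \<gamma> \<in> punctured_disk 1"
    using pathstart_in_path_image[of \<gamma>] pathfinish_in_path_image[of \<gamma>] by auto
  then show "f (pathfinish \<gamma>) $ k - f (pathstart \<gamma>) $ k = Re (contour_integral \<gamma> (\<lambda>z. \<phi> z $ k))"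
    using Re_cubic_contour_integral[OF g H] \<gamma> f by simp
qed

section \<open>Derivatives, affine equivalence and reduced form\<close>

lemma end_component_has_derivative:
  assumes f: "end_with_forms f \<phi>" and z: "z \<in> punctured_disk 1"
  shows "((\<lambda>w. f w $ k) has_derivative (\<lambda>h. Re (\<phi> z $ k * h))) (at z)"
proof -
  have f': "is_real_integral f \<phi>" "(\<lambda>z. \<phi> z $ k) holomorphic_on punctured_disk 1"
    using f by (auto simp: end_with_forms_def meromorphic_forms_def)
  obtain e where e: "e > 0" "ball z e \<subseteq> punctured_disk 1"
    using open_punctured_disk z openE by blast
  have hol: "(\<lambda>z. \<phi> z $ k) holomorphic_on ball z e"
    using f'(2) e(2) holomorphic_on_subset by blast
  obtain \<Phi> where \<Phi>: "\<And>w. w \<in> ball z e \<Longrightarrow> (\<Phi> has_field_derivative \<phi> w $ k) (at w within ball z e)"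
    using holomorphic_convex_primitive'[OF _ _ hol] by auto
  have "((\<lambda>w. (f z $ k - Re (\<Phi> z)) + Re (\<Phi> w)) has_derivative (\<lambda>h. Re (\<phi> z $ k * h))) (at z)"
  proof -
    have "(\<Phi> has_field_derivative \<phi> z $ k) (at z)"
      using \<Phi>[of z] e(1) by (simp add: at_within_open_NO_MATCH)
    then have "((\<lambda>w. Re (\<Phi> w)) has_derivative (\<lambda>h. Re (\<phi> z $ k * h))) (at z)"
      unfolding has_field_derivative_def by (rule bounded_linear.has_derivative[OF bounded_linear_Re])
    from has_derivative_add[OF has_derivative_const[of "f z $ k - Re (\<Phi> z)"] this]
    show ?thesis by (simp only: add_0)
  qed
  then show ?thesis
  proof (rule has_derivative_transform_within_open[OF _ open_ball[of z e]])
    show "z \<in> ball z e" using e(1) by simp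
    fix w assume "w \<in> ball z e"
    then have seg: "path_image (linepath z w) \<subseteq> ball z e"
      using e(1) by (simp add: closed_segment_subset)
    have "(\<lambda>w. \<phi> w $ k) contour_integrable_on linepath z w \<and>
        contour_integral (linepath z w) (\<lambda>w. \<phi> w $ k) = \<Phi> w - \<Phi> z"
      using contour_integral_primitive[of "ball z e" \<Phi> "\<lambda>w. \<phi> w $ k" "linepath z w"] \<Phi> seg
      by (auto simp: contour_integrable_on_def contour_integral_unique)
    moreover have "f w $ k - f z $ k = Re (contour_integral (linepath z w) (\<lambda>w. \<phi> w $ k))"
      using f'(1) seg e(2) unfolding is_real_integral_def
      by (metis pathfinish_linepath pathstart_linepath subset_trans valid_path_linepath)
    ultimately show "(f z $ k - Re (\<Phi> z)) + Re (\<Phi> w) = f w $ k" by simp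
  qed
qed

lemma vec_has_derivativeI:
  fixes f :: "'a::real_normed_vector \<Rightarrow> real ^ 'n"
  assumes "\<And>k. ((\<lambda>x. f x $ k) has_derivative (\<lambda>h. f' h $ k)) F"
  shows "(f has_derivative f') F"
proof -
  have "((\<lambda>x. \<Sum>k\<in>UNIV. f x $ k *\<^sub>R axis k (1::real)) has_derivative
      (\<lambda>h. \<Sum>k\<in>UNIV. f' h $ k *\<^sub>R axis k (1::real))) F"
    by (intro has_derivative_sum bounded_linear.has_derivative[OF bounded_linear_scaleR_left] assms)
  moreover have "(\<lambda>x. \<Sum>k\<in>UNIV. g x $ k *\<^sub>R axis k (1::real)) = g" for g :: "'a \<Rightarrow> real ^ 'n"
    using basis_expansion[where ?'a = real] by (auto simp: scalar_mult_eq_scaleR)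
  ultimately show ?thesis by simp
qed

lemma end_has_derivative:
  assumes "end_with_forms f \<phi>" "z \<in> punctured_disk 1"
  shows "(f has_derivative (\<lambda>h. \<chi> k. Re (\<phi> z $ k * h))) (at z)"
  by (rule vec_has_derivativeI) (use end_component_has_derivative[OF assms] in simp)

lemma end_continuous_on:
  assumes "end_with_forms f \<phi>"
  shows "continuous_on (punctured_disk 1) (\<lambda>z. f z $ k)"
  using end_component_has_derivative[OF assms]
  by (meson has_derivative_at_withinI has_derivative_continuous_on)

text \<open>The derivative in the directions \<open>1\<close> and \<open>\<i>\<close> gives the real
  part and minus the imaginary part of each coefficient. Hence the pole orders of an end do not
  depend on the forms chosen to represent it.\<close>

lemma end_forms_unique:
  assumes "end_with_forms f \<phi>" "end_with_forms f \<psi>" and z: "z \<in> punctured_disk 1"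
  shows "\<phi> z = \<psi> z"
proof -
  have "\<phi> z $ k = \<psi> z $ k" for k
  proof -
    have "(\<lambda>h. Re (\<phi> z $ k * h)) = (\<lambda>h. Re (\<psi> z $ k * h))"
      using end_component_has_derivative[OF assms(1) z] end_component_has_derivative[OF assms(2) z]
      by (rule has_derivative_unique)
    then have "Re (\<phi> z $ k * h) = Re (\<psi> z $ k * h)" for h by meson
    from this[of 1] this[of \<i>] show ?thesis by (simp add: complex_eq_iff)
  qed
  then show ?thesis by (simp add: vec_eq_iff)
qed

lemma end_immersion_onI:
  assumes f: "end_with_forms f \<phi>" and S: "S \<subseteq> punctured_disk 1"
    and inj: "\<And>z h. z \<in> S \<Longrightarrow> (\<And>k. Re (\<phi> z $ k * h) = 0) \<Longrightarrow> h = 0"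
  shows "immersion_on f S"
  unfolding immersion_on_def
proof (intro ballI exI conjI)
  fix z assume z: "z \<in> S"
  show "(f has_derivative (\<lambda>h. \<chi> k. Re (\<phi> z $ k * h))) (at z)"
    using end_has_derivative[OF f] S z by blast
  show "inj (\<lambda>h. \<chi> k. Re (\<phi> z $ k * h))"
  proof (rule injI)
    fix h h' assume "(\<chi> k. Re (\<phi> z $ k * h)) = (\<chi> k. Re (\<phi> z $ k * h'))"
    then have "Re (\<phi> z $ k * (h - h')) = 0" for k
      by (simp add: vec_eq_iff right_diff_distrib)
    then have "h - h' = 0" using inj[OF z] by blast
    then show "h = h'" by simp
  qed
qed

section \<open>Affine maps acting on ends and their forms\<close>

text \<open>The coefficients are real because they form a row of the real matrix of an affine map;
  the translation disappears on differentiation.\<close>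

definition real_combination :: "real ^ 3 \<Rightarrow> (complex \<Rightarrow> complex ^ 3) \<Rightarrow> complex \<Rightarrow> complex" where
  "real_combination c \<phi> z = of_real (c $ 1) * \<phi> z $ 1 + of_real (c $ 2) * \<phi> z $ 2 + of_real (c $ 3) * \<phi> z $ 3"

definition transform_forms :: "real ^ 3 ^ 3 \<Rightarrow> (complex \<Rightarrow> complex ^ 3) \<Rightarrow> complex \<Rightarrow> complex ^ 3" where
  "transform_forms M \<phi> z = (\<chi> k. real_combination (M $ k) \<phi> z)"

lemma end_with_forms_transform:
  assumes f: "end_with_forms f \<phi>" and g: "\<And>z. z \<in> punctured_disk 1 \<Longrightarrow> g z = M *v f z + b"
  shows "end_with_forms g (transform_forms M \<phi>)"
proof -
  have hol: "(\<lambda>z. \<phi> z $ k) holomorphic_on punctured_disk 1" and mer: "(\<lambda>z. \<phi> z $ k) meromorphic_on {0}" for k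
    using f by (auto simp: end_with_forms_def meromorphic_forms_def)
  have "meromorphic_forms (transform_forms M \<phi>)"
    unfolding meromorphic_forms_def transform_forms_def real_combination_def
    by (auto intro!: holomorphic_intros meromorphic_intros hol mer)
  moreover have "is_real_integral g (transform_forms M \<phi>)"
    unfolding is_real_integral_def
  proof (intro allI impI)
    fix \<gamma> k assume \<gamma>: "valid_path \<gamma> \<and> path_image \<gamma> \<subseteq> punctured_disk 1"
    then have ends: "pathstart \<gamma> \<in> punctured_disk 1" "pathfinish \<gamma> \<in> punctured_disk 1"
      using pathstart_in_path_image[of \<gamma>] pathfinish_in_path_image[of \<gamma>] by auto
    have int: "((\<lambda>z. \<phi> z $ j) has_contour_integral contour_integral \<gamma> (\<lambda>z. \<phi> z $ j)) \<gamma>" for j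
      using contour_integrable_holomorphic_simple[OF hol open_punctured_disk] \<gamma>
      by (auto intro: has_contour_integral_integral)
    have "((\<lambda>z. transform_forms M \<phi> z $ k) has_contour_integral
       (of_real (M $ k $ 1) * contour_integral \<gamma> (\<lambda>z. \<phi> z $ 1)
       + of_real (M $ k $ 2) * contour_integral \<gamma> (\<lambda>z. \<phi> z $ 2)
       + of_real (M $ k $ 3) * contour_integral \<gamma> (\<lambda>z. \<phi> z $ 3))) \<gamma>"
      unfolding transform_forms_def real_combination_def vec_lambda_beta
      by (intro has_contour_integral_add has_contour_integral_lmul int)
    moreover have "f (pathfinish \<gamma>) $ j = f (pathstart \<gamma>) $ j + Re (contour_integral \<gamma> (\<lambda>z. \<phi> z $ j))" for j
      using f \<gamma> unfolding end_with_forms_def is_real_integral_def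
      by (metis add.commute diff_add_cancel)
    ultimately show "g (pathfinish \<gamma>) $ k - g (pathstart \<gamma>) $ k =
        Re (contour_integral \<gamma> (\<lambda>z. transform_forms M \<phi> z $ k))"
      using g ends
      by (auto simp: matrix_vector_mult_def sum_3 algebra_simps dest!: contour_integral_unique)
  qed
  ultimately show ?thesis by (simp add: end_with_forms_def)
qed

lemma affinely_equivalent_sym:
  assumes "affinely_equivalent f g"
  shows "affinely_equivalent g f"
proof -
  obtain M :: "real ^ 3 ^ 3" and b where M: "invertible M"
      and g: "\<And>z. z \<in> punctured_disk 1 \<Longrightarrow> g z = M *v f z + b"
    using assms by (auto simp: affinely_equivalent_def)
  obtain N where N: "M ** N = mat 1" "N ** M = mat 1" using M by (auto simp: invertible_def)
  have "f z = N *v g z + (- (N *v b))" if "z \<in> punctured_disk 1" for z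
    using g[OF that] N by (simp add: matrix_vector_right_distrib matrix_vector_mul_assoc)
  moreover have "invertible N" using N by (auto simp: invertible_def)
  ultimately show ?thesis unfolding affinely_equivalent_def by blast
qed

lemma affinely_equivalent_refl: "affinely_equivalent f f"
  unfolding affinely_equivalent_def by (rule exI[of _ "mat 1"]) (auto simp: invertible_def intro!: exI[of _ "mat 1"])

text \<open>The inverse matrix \<open>N\<close> is bounded, so the norm of \<open>f z\<close> is at
  most a constant times that of \<open>M *v f z\<close>.\<close>

lemma norm_affine_at_top:
  assumes M: "invertible (M :: real ^ 3 ^ 3)" and f: "filterlim (\<lambda>z. norm (f z)) at_top F"
  shows "filterlim (\<lambda>z. norm (M *v f z + b)) at_top F"
proof -
  obtain N where N: "N ** M = mat 1" using M by (auto simp: invertible_def)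
  have "bounded_linear (\<lambda>x. N *v x)" by simp
  then obtain K where K: "K > 0" "\<And>x. norm (N *v x) \<le> norm x * K"
    using bounded_linear.pos_bounded by blast
  have bound: "norm (f z) / K - norm b \<le> norm (M *v f z + b)" for z
  proof -
    have "norm (f z) = norm (N *v (M *v f z))" using N by (simp add: matrix_vector_mul_assoc)
    also have "\<dots> \<le> norm (M *v f z) * K" by (rule K)
    also have "\<dots> \<le> (norm (M *v f z + b) + norm b) * K"
      using norm_triangle_ineq4[of "M *v f z + b" b] K(1) by (intro mult_right_mono) auto
    finally show ?thesis using K(1) by (simp add: field_simps)
  qed
  have "filterlim (\<lambda>z. (1 / K) * norm (f z)) at_top F"
    by (rule filterlim_tendsto_pos_mult_at_top[OF tendsto_const _ f]) (use K in auto)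
  then have "filterlim (\<lambda>z. - norm b + (1 / K) * norm (f z)) at_top F"
    by (rule filterlim_tendsto_add_at_top[OF tendsto_const])
  then show ?thesis
    by (rule filterlim_at_top_mono) (use bound in \<open>auto simp: field_simps intro!: always_eventually\<close>)
qed

text \<open>This transfers both positive and negative results between an end and its reduced
  representative.\<close>

lemma properly_embedded_affine:
  assumes "affinely_equivalent f g" and f: "properly_embedded f"
  shows "properly_embedded g"
proof -
  obtain M :: "real ^ 3 ^ 3" and b where M: "invertible M"
      and g: "\<And>z. z \<in> punctured_disk 1 \<Longrightarrow> g z = M *v f z + b"
    using assms by (auto simp: affinely_equivalent_def)
  have inj: "inj (\<lambda>x. M *v x)"
    using M by (metis (no_types, lifting) injI invertible_def matrix_vector_mul_assoc matrix_vector_mul_lid)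
  obtain r where r: "0 < r" "r \<le> 1" "inj_on f (punctured_disk r)" "immersion_on f (punctured_disk r)"
    using f by (auto simp: properly_embedded_def)
  have sub: "punctured_disk r \<subseteq> punctured_disk 1" using r(2) by (auto simp: punctured_disk_iff)
  have "filterlim (\<lambda>z. norm (M *v f z + b)) at_top (at 0)"
    by (rule norm_affine_at_top[OF M]) (use f in \<open>simp add: properly_embedded_def proper_end_def\<close>)
  moreover have "eventually (\<lambda>z. norm (g z) = norm (M *v f z + b)) (at 0)"
    using eventually_punctured_disk[of 1] by (rule eventually_mono) (use g in auto)
  ultimately have "proper_end g"
    unfolding proper_end_def by (simp add: filterlim_cong)
  moreover have "inj_on g (punctured_disk r)"
    using r(3) sub inj by (auto simp: inj_on_def g subset_iff)
  moreover have "immersion_on g (punctured_disk r)"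
    unfolding immersion_on_def
  proof
    fix z assume z: "z \<in> punctured_disk r"
    then obtain f' where f': "(f has_derivative f') (at z)" "inj f'"
      using r(4) by (auto simp: immersion_on_def)
    have "((\<lambda>z. M *v f z + b) has_derivative (\<lambda>h. M *v f' h)) (at z)"
      using bounded_linear.has_derivative[OF matrix_vector_mul_bounded_linear f'(1)]
      by (auto intro!: derivative_eq_intros)
    then have "(g has_derivative (\<lambda>h. M *v f' h)) (at z)"
      by (rule has_derivative_transform_within_open[OF _ open_punctured_disk[of 1]]) (use z sub g in auto)
    moreover have "inj (\<lambda>h. M *v f' h)" using inj_compose[OF inj f'(2)] by (simp add: o_def)
    ultimately show "\<exists>g'. (g has_derivative g') (at z) \<and> inj g'" by blast
  qed
  ultimately show ?thesis using r by (auto simp: properly_embedded_def)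
qed

section \<open>Exploiting and certifying reducedness\<close>

lemma reduced_forms:
  assumes "reduced_with_orders f (n1, n2, n3)"
  obtains \<phi> where "end_with_forms f \<phi>" "pole_order (\<lambda>z. \<phi> z $ 1) = n1"
    "pole_order (\<lambda>z. \<phi> z $ 2) = n2" "pole_order (\<lambda>z. \<phi> z $ 3) = n3"
  using assms unfolding reduced_with_orders_def has_pole_orders_def by auto

text \<open>The way minimality is used: each contradiction below takes for \<open>M\<close> a
  unitriangular matrix whose only nontrivial row lowers a pole order.\<close>

lemma reduced_combination_orders:
  assumes f: "end_with_forms f \<phi>" and red: "reduced_with_orders f n" and M: "det (M :: real ^ 3 ^ 3) \<noteq> 0"
  shows "((pole_order (real_combination (M $ 1) \<phi>), pole_order (real_combination (M $ 2) \<phi>),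
     pole_order (real_combination (M $ 3) \<phi>)), n) \<notin> lex_less"
proof -
  let ?g = "\<lambda>z. M *v f z"
  have "affinely_equivalent f ?g"
    unfolding affinely_equivalent_def using M by (intro exI[of _ M] exI[of _ 0]) (auto simp: invertible_det_nz)
  moreover have "end_with_forms ?g (transform_forms M \<phi>)"
    by (rule end_with_forms_transform[OF f, where b = 0]) simp
  then have "has_pole_orders ?g (pole_order (real_combination (M $ 1) \<phi>),
      pole_order (real_combination (M $ 2) \<phi>), pole_order (real_combination (M $ 3) \<phi>))"
    unfolding has_pole_orders_def by (intro exI conjI) (auto simp: transform_forms_def)
  ultimately show ?thesis using red by (auto simp: reduced_with_orders_def)
qed

text \<open>A certificate for the examples. The hypothesis says that leading terms never cancel in a
  real combination; for \<open>n1 = n2\<close> it includes the real independence of the first two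
  leading coefficients.\<close>

lemma reduced_with_ordersI:
  assumes f: "end_with_forms f \<phi>" and n: "n1 \<le> n2" "n2 < n3"
    and ord: "\<And>c. c \<noteq> 0 \<Longrightarrow> pole_order (real_combination c \<phi>) =
      (if c $ 3 \<noteq> 0 then n3 else if c $ 2 \<noteq> 0 then n2 else n1)"
  shows "reduced_with_orders f (n1, n2, n3)"
  unfolding reduced_with_orders_def
proof (intro conjI allI impI)
  have "real_combination (axis k 1) \<phi> = (\<lambda>z. \<phi> z $ k)" for k
    using exhaust_3[of k] by (auto simp: real_combination_def axis_def)
  then have "pole_order (\<lambda>z. \<phi> z $ k) = (if k = 3 then n3 else if k = 2 then n2 else n1)" for k
    using ord[of "axis k 1"] by (auto simp: axis_def vec_eq_iff split: if_splits)
  then show "has_pole_orders f (n1, n2, n3)"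
    unfolding has_pole_orders_def using f by (intro exI[of _ \<phi>]) auto
  show "case (n1, n2, n3) of (n1, n2, n3) \<Rightarrow> n1 \<le> n2 \<and> n2 \<le> n3" using n by simp
  fix g m assume "affinely_equivalent f g \<and> has_pole_orders g m"
  then obtain M :: "real ^ 3 ^ 3" and b \<psi> where M: "invertible M"
      and g: "\<And>z. z \<in> punctured_disk 1 \<Longrightarrow> g z = M *v f z + b"
      and \<psi>: "end_with_forms g \<psi>"
      and m: "m = (pole_order (\<lambda>z. \<psi> z $ 1), pole_order (\<lambda>z. \<psi> z $ 2), pole_order (\<lambda>z. \<psi> z $ 3))"
    by (auto simp: affinely_equivalent_def has_pole_orders_def)
  have "pole_order (\<lambda>z. \<psi> z $ k) = pole_order (real_combination (M $ k) \<phi>)" for k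
    using end_forms_unique[OF \<psi> end_with_forms_transform[OF f g]]
    by (intro pole_order_cong) (auto simp: transform_forms_def)
  moreover have det: "det M \<noteq> 0" using M by (simp add: invertible_det_nz)
  then have "M $ k \<noteq> 0" for k using det_zero_row(1)[of k M] by (auto simp: row_def vec_eq_iff)
  ultimately have m': "m = (if M $ 1 $ 3 \<noteq> 0 then n3 else if M $ 1 $ 2 \<noteq> 0 then n2 else n1,
      if M $ 2 $ 3 \<noteq> 0 then n3 else if M $ 2 $ 2 \<noteq> 0 then n2 else n1,
      if M $ 3 $ 3 \<noteq> 0 then n3 else if M $ 3 $ 2 \<noteq> 0 then n2 else n1)"
    using m ord by simp
  \<comment> \<open>Every entry of \<open>m\<close> is at least \<open>n1\<close>. If
    \<open>m\<close> were smaller, then either the first two rows of \<open>M\<close> would be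
    supported in the first column, or the third column of \<open>M\<close> would vanish; both
    contradict \<open>det M \<noteq> 0\<close>.\<close>
  show "(m, (n1, n2, n3)) \<notin> lex_less"
    using det n unfolding m' lex_less_def det_3 by (auto split: if_splits)
qed

section \<open>Leading coefficients of reduced ends\<close>

definition cubic_end where
  "cubic_end f \<phi> a b c h H \<longleftrightarrow> end_with_forms f \<phi> \<and>
     (\<forall>k. cubic_pole_form (\<lambda>z. \<phi> z $ k) (a k) (b k) (of_real (c k)) (h k) \<and>
       (\<forall>z\<in>ball 0 1. (H k has_field_derivative h k z) (at z)) \<and>
       (\<forall>z\<in>punctured_disk 1. f z $ k = cubic_potential (a k) (b k) (c k) (H k) z))"

lemma cubic_endD:
  assumes "cubic_end f \<phi> a b c h H"
  shows "end_with_forms f \<phi>"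
    and "\<And>k. cubic_pole_form (\<lambda>z. \<phi> z $ k) (a k) (b k) (of_real (c k)) (h k)"
    and "\<And>k z. z \<in> ball 0 1 \<Longrightarrow> (H k has_field_derivative h k z) (at z)"
    and "\<And>k z. z \<in> punctured_disk 1 \<Longrightarrow> f z $ k = cubic_potential (a k) (b k) (c k) (H k) z"
  using assms unfolding cubic_end_def by auto

lemma reduced_cubic_end:
  assumes red: "reduced_with_orders f (n1, n2, n3)" and n3: "n3 \<le> 3"
  obtains \<phi> a b c h H where "cubic_end f \<phi> a b c h H" "pole_order (\<lambda>z. \<phi> z $ 1) = n1"
    "pole_order (\<lambda>z. \<phi> z $ 2) = n2" "pole_order (\<lambda>z. \<phi> z $ 3) = n3"
proof -
  obtain \<phi> where \<phi>: "end_with_forms f \<phi>" "pole_order (\<lambda>z. \<phi> z $ 1) = n1"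
      "pole_order (\<lambda>z. \<phi> z $ 2) = n2" "pole_order (\<lambda>z. \<phi> z $ 3) = n3"
    using reduced_forms[OF red] by blast
  have "n1 \<le> n2" "n2 \<le> n3" using red by (auto simp: reduced_with_orders_def)
  then have "pole_order (\<lambda>z. \<phi> z $ k) \<le> 3" for k
    using exhaust_3[of k] \<phi> n3 by auto
  then have "\<exists>a b c h H. cubic_pole_form (\<lambda>z. \<phi> z $ k) a b (of_real c) h \<and>
      (\<forall>z\<in>ball 0 1. (H has_field_derivative h z) (at z)) \<and>
      (\<forall>z\<in>punctured_disk 1. f z $ k = cubic_potential a b c H z)" for k
    using cubic_end_component[OF \<phi>(1)] by metis
  then obtain a b c h H where "\<And>k. cubic_pole_form (\<lambda>z. \<phi> z $ k) (a k) (b k) (of_real (c k)) (h k) \<and>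
      (\<forall>z\<in>ball 0 1. (H k has_field_derivative h k z) (at z)) \<and>
      (\<forall>z\<in>punctured_disk 1. f z $ k = cubic_potential (a k) (b k) (c k) (H k) z)"
    by metis
  then have "cubic_end f \<phi> a b c h H" using \<phi>(1) by (simp add: cubic_end_def)
  then show ?thesis using that \<phi> by blast
qed

lemma cubic_pole_form_combination:
  assumes "\<And>k. cubic_pole_form (\<lambda>z. \<phi> z $ k) (a k) (b k) (c k) (h k)"
  shows "cubic_pole_form (real_combination v \<phi>)
    (of_real (v $ 1) * a 1 + of_real (v $ 2) * a 2 + of_real (v $ 3) * a 3)
    (of_real (v $ 1) * b 1 + of_real (v $ 2) * b 2 + of_real (v $ 3) * b 3)
    (of_real (v $ 1) * c 1 + of_real (v $ 2) * c 2 + of_real (v $ 3) * c 3)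
    (\<lambda>z. of_real (v $ 1) * h 1 z + of_real (v $ 2) * h 2 z + of_real (v $ 3) * h 3 z)"
  using assms unfolding cubic_pole_form_def real_combination_def
  by (auto intro!: holomorphic_intros simp: algebra_simps add_divide_distrib)

lemma pole_order_cubic_pole_form_iff:
  assumes "cubic_pole_form g a b c h"
  shows "pole_order g = 0 \<longleftrightarrow> a = 0 \<and> b = 0 \<and> c = 0"
    and "pole_order g = 1 \<longleftrightarrow> a = 0 \<and> b = 0 \<and> c \<noteq> 0"
    and "pole_order g = 2 \<longleftrightarrow> a = 0 \<and> b \<noteq> 0"
    and "pole_order g = 3 \<longleftrightarrow> a \<noteq> 0"
  unfolding pole_order_cubic_pole_form[OF assms] by auto

text \<open>\<open>Im (a * cnj b)\<close> is, up to sign, the determinant of \<open>a\<close> and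
  \<open>b\<close> as vectors in the real plane; throughout, its vanishing encodes linear dependence
  over the reals.\<close>

lemma real_multiple_if_dependent:
  assumes "Im (a * cnj b) = 0" "b \<noteq> 0"
  obtains s where "a = of_real s * b"
proof
  have 1: "a * cnj b = of_real (Re (a * cnj b))" using assms(1) by (simp add: complex_eq_iff)
  have 2: "b * cnj b = of_real ((norm b)\<^sup>2)" by (rule complex_norm_square[symmetric])
  have "a = (a * cnj b) * b / (b * cnj b)" using assms(2) by simp
  also have "\<dots> = of_real (Re (a * cnj b) / (norm b)\<^sup>2) * b"
    by (subst 1, subst 2) (simp only: of_real_divide times_divide_eq_left)
  finally show "a = of_real (Re (a * cnj b) / (norm b)\<^sup>2) * b" .
qed

lemma real_span_if_independent:
  assumes "Im (a * cnj b) \<noteq> 0"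
  obtains s t where "u = of_real s * a + of_real t * b"
proof
  define D where "D = Im (a * cnj b)"
  \<comment> \<open>Cramer's rule in the real basis \<open>a\<close>, \<open>b\<close>.\<close>
  have eq: "of_real D * u =
      of_real (Im u * Re b - Re u * Im b) * a + of_real (Im a * Re u - Re a * Im u) * b"
    by (simp add: D_def complex_eq_iff algebra_simps)
  have "D \<noteq> 0" using assms by (simp only: D_def not_False_eq_True)
  then have "u = (of_real D * u) / of_real D" by simp
  also have "\<dots> = of_real ((Im u * Re b - Re u * Im b) / D) * a + of_real ((Im a * Re u - Re a * Im u) / D) * b"
    unfolding eq by (simp only: add_divide_distrib of_real_divide times_divide_eq_left)
  finally show "u = of_real ((Im u * Re b - Re u * Im b) / D) * a + of_real ((Im a * Re u - Re a * Im u) / D) * b" .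
qed

text \<open>If one leading coefficient were a real multiple of the other, subtracting a multiple of
  the third coordinate from the second would lower the second pole order and leave the first one as
  it is.\<close>

lemma reduced_last_pair_independent:
  assumes red: "reduced_with_orders f (n, 3, 3)" and f: "end_with_forms f \<phi>"
    and ord: "pole_order (\<lambda>z. \<phi> z $ 1) = n" "pole_order (\<lambda>z. \<phi> z $ 3) = 3"
    and forms: "\<And>k. cubic_pole_form (\<lambda>z. \<phi> z $ k) (a k) (b k) (c k) (h k)"
  shows "Im (a 2 * cnj (a 3)) \<noteq> 0"
proof
  assume *: "Im (a 2 * cnj (a 3)) = 0"
  have "a 3 \<noteq> 0" using pole_order_cubic_pole_form_iff(4)[OF forms[of 3]] ord by simp
  with * obtain s where s: "a 2 = of_real s * a 3" by (rule real_multiple_if_dependent)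
  let ?M = "vector [vector [1, 0, 0], vector [0, 1, - s], vector [0, 0, 1]] :: real ^ 3 ^ 3"
  have "pole_order (real_combination (?M $ 1) \<phi>) = n"
    using ord(1) by (simp add: real_combination_def[abs_def])
  moreover have "pole_order (real_combination (?M $ 2) \<phi>) < 3"
    unfolding pole_order_cubic_pole_form[OF cubic_pole_form_combination[OF forms]] using s by simp
  moreover have "det ?M \<noteq> 0" by (simp add: det_3)
  ultimately show False
    using reduced_combination_orders[OF f red, of ?M] by (simp add: lex_less_def)
qed

text \<open>Here the row operation lowers the first entry, which alone decides the lexicographic
  comparison.\<close>

lemma reduced_223_first_pair_independent:
  assumes red: "reduced_with_orders f (2, 2, 3)" and f: "end_with_forms f \<phi>"
    and ord: "pole_order (\<lambda>z. \<phi> z $ 1) = 2" "pole_order (\<lambda>z. \<phi> z $ 2) = 2"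
    and forms: "\<And>k. cubic_pole_form (\<lambda>z. \<phi> z $ k) (a k) (b k) (c k) (h k)"
  shows "a 1 = 0" "a 2 = 0" "Im (b 1 * cnj (b 2)) \<noteq> 0"
proof -
  show a: "a 1 = 0" "a 2 = 0"
    using pole_order_cubic_pole_form_iff(3)[OF forms[of 1]] pole_order_cubic_pole_form_iff(3)[OF forms[of 2]] ord
    by simp_all
  have "b 2 \<noteq> 0" using pole_order_cubic_pole_form_iff(3)[OF forms[of 2]] ord by simp
  show "Im (b 1 * cnj (b 2)) \<noteq> 0"
  proof
    assume "Im (b 1 * cnj (b 2)) = 0"
    then obtain s where s: "b 1 = of_real s * b 2" using \<open>b 2 \<noteq> 0\<close> by (rule real_multiple_if_dependent)
    let ?M = "vector [vector [1, - s, 0], vector [0, 1, 0], vector [0, 0, 1]] :: real ^ 3 ^ 3"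
    have "pole_order (real_combination (?M $ 1) \<phi>) < 2"
      unfolding pole_order_cubic_pole_form[OF cubic_pole_form_combination[OF forms]] using s a by simp
    moreover have "det ?M \<noteq> 0" by (simp add: det_3)
    ultimately show False
      using reduced_combination_orders[OF f red, of ?M] by (simp add: lex_less_def)
  qed
qed

lemma not_reduced_113: "\<not> reduced_with_orders f (1, 1, 3)"
proof
  assume red: "reduced_with_orders f (1, 1, 3)"
  obtain \<phi> a b c h H where ce: "cubic_end f \<phi> a b c h H"
      and ord: "pole_order (\<lambda>z. \<phi> z $ 1) = 1" "pole_order (\<lambda>z. \<phi> z $ 2) = 1" "pole_order (\<lambda>z. \<phi> z $ 3) = 3"
    by (rule reduced_cubic_end[OF red order_refl])
  note f = cubic_endD(1)[OF ce] and forms = cubic_endD(2)[OF ce]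
  have z: "a 1 = 0" "a 2 = 0" "b 1 = 0" "b 2 = 0" "c 2 \<noteq> 0"
    using pole_order_cubic_pole_form_iff(2)[OF forms[of 1]] pole_order_cubic_pole_form_iff(2)[OF forms[of 2]] ord
    by simp_all
  let ?M = "vector [vector [1, - c 1 / c 2, 0], vector [0, 1, 0], vector [0, 0, 1]] :: real ^ 3 ^ 3"
  have "pole_order (real_combination (?M $ 1) \<phi>) < 1"
    unfolding pole_order_cubic_pole_form[OF cubic_pole_form_combination[OF forms]] using z by simp
  moreover have "det ?M \<noteq> 0" by (simp add: det_3)
  ultimately show False
    using reduced_combination_orders[OF f red, of ?M] by (simp add: lex_less_def)
qed

text \<open>The complex plane has real dimension 2: once \<open>a 2\<close> and \<open>a 3\<close>
  are independent, \<open>a 1\<close> is a real combination of them and can be cancelled.\<close>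

lemma not_reduced_333: "\<not> reduced_with_orders f (3, 3, 3)"
proof
  assume red: "reduced_with_orders f (3, 3, 3)"
  obtain \<phi> a b c h H where ce: "cubic_end f \<phi> a b c h H"
      and ord: "pole_order (\<lambda>z. \<phi> z $ 1) = 3" "pole_order (\<lambda>z. \<phi> z $ 2) = 3" "pole_order (\<lambda>z. \<phi> z $ 3) = 3"
    by (rule reduced_cubic_end[OF red order_refl])
  note f = cubic_endD(1)[OF ce] and forms = cubic_endD(2)[OF ce]
  obtain s t where st: "a 1 = of_real s * a 2 + of_real t * a 3"
    using reduced_last_pair_independent[OF red f ord(1,3) forms] by (rule real_span_if_independent)
  let ?M = "vector [vector [1, - s, - t], vector [0, 1, 0], vector [0, 0, 1]] :: real ^ 3 ^ 3"
  have "pole_order (real_combination (?M $ 1) \<phi>) < 3"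
    unfolding pole_order_cubic_pole_form[OF cubic_pole_form_combination[OF forms]] using st by simp
  moreover have "det ?M \<noteq> 0" by (simp add: det_3)
  ultimately show False
    using reduced_combination_orders[OF f red, of ?M] by (simp add: lex_less_def)
qed

text \<open>Of the ten pairs with \<open>n1 \<le> n2 \<le> 3\<close>, minimality rules out exactly
  (1,1) and (3,3).\<close>

lemma has_order_3_types:
  assumes "has_order f 3"
  shows "\<exists>t \<in> {(2,2,3), (1,2,3), (0,2,3), (0,1,3), (2,3,3), (1,3,3), (0,3,3), (0,0,3)}. has_type f t"
proof -
  obtain n1 n2 g where g: "affinely_equivalent f g" "reduced_with_orders g (n1, n2, 3)"
    using assms by (auto simp: has_order_def has_type_def)
  have "n1 \<le> n2" "n2 \<le> 3" using g(2) by (auto simp: reduced_with_orders_def)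
  moreover have "(n1, n2) \<noteq> (1, 1)" "(n1, n2) \<noteq> (3, 3)"
    using g(2) not_reduced_113 not_reduced_333 by auto
  moreover have "n2 = 0 \<or> n2 = 1 \<or> n2 = 2 \<or> n2 = 3" using \<open>n2 \<le> 3\<close> by linarith
  moreover have "n1 = 0 \<or> n1 = 1 \<or> n1 = 2 \<or> n1 = 3" using \<open>n1 \<le> n2\<close> \<open>n2 \<le> 3\<close> by linarith
  ultimately have "(n1, n2, 3) \<in>
      {(2,2,3), (1,2,3), (0,2,3), (0,1,3), (2,3,3), (1,3,3), (0,3,3), (0,0,3::nat)}"
    by (elim disjE) simp_all
  then show ?thesis using g unfolding has_type_def by blast
qed

section \<open>Ends of type (0,0,3)\<close>

text \<open>Scaling by the square of \<open>r\<close> isolates the leading term along a ray, because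
  the simple pole, \<open>H\<close> and the logarithm all tend to 0. For small \<open>r\<close> the
  potential thus has the sign of the limit, if that is nonzero.\<close>

lemma cubic_potential_ray:
  assumes "isCont H 0" "w \<noteq> 0"
  shows "((\<lambda>r. r\<^sup>2 * cubic_potential a b c H (of_real r * w)) \<longlongrightarrow> Re (- a / (2 * w\<^sup>2))) (at_right 0)"
proof -
  have r: "((\<lambda>r. complex_of_real r * w) \<longlongrightarrow> 0) (at_right 0)"
    by (auto intro!: tendsto_eq_intros)
  have H: "((\<lambda>r. H (complex_of_real r * w)) \<longlongrightarrow> H 0) (at_right 0)"
    using isCont_tendsto_compose[OF assms(1) r] by simp
  have "((\<lambda>r::real. r\<^sup>2 * ln r) \<longlongrightarrow> 0) (at_right 0)" by real_asymp
  then have "((\<lambda>r. Re (- a / (2 * w\<^sup>2) - of_real r * b / w + (of_real r)\<^sup>2 * H (of_real r * w))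
        + (c * ln (norm w) * r\<^sup>2 + c * (r\<^sup>2 * ln r)))
      \<longlongrightarrow> Re (- a / (2 * w\<^sup>2) - of_real 0 * b / w + (of_real 0)\<^sup>2 * H 0)
        + (c * ln (norm w) * 0\<^sup>2 + c * 0)) (at_right 0)"
    by (intro tendsto_intros H) (use assms(2) in auto)
  then have lim: "((\<lambda>r. Re (- a / (2 * w\<^sup>2) - of_real r * b / w + (of_real r)\<^sup>2 * H (of_real r * w))
        + (c * ln (norm w) * r\<^sup>2 + c * (r\<^sup>2 * ln r))) \<longlongrightarrow> Re (- a / (2 * w\<^sup>2))) (at_right 0)"
    by simp
  have "eventually (\<lambda>r::real. r > 0) (at_right 0)"
    by (rule eventually_at_right_less)
  then have "eventually (\<lambda>r. Re (- a / (2 * w\<^sup>2) - of_real r * b / w + (of_real r)\<^sup>2 * H (of_real r * w))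
        + (c * ln (norm w) * r\<^sup>2 + c * (r\<^sup>2 * ln r)) = r\<^sup>2 * cubic_potential a b c H (of_real r * w)) (at_right 0)"
  proof (rule eventually_mono)
    fix r :: real assume r: "r > 0"
    let ?R = "complex_of_real r"
    have "?R\<^sup>2 * (- a / (2 * (?R * w)\<^sup>2) - b / (?R * w) + H (?R * w)) =
        - a / (2 * w\<^sup>2) - ?R * b / w + ?R\<^sup>2 * H (?R * w)"
      using r assms(2) by (simp add: field_simps power2_eq_square)
    then have "r\<^sup>2 * Re (- a / (2 * (?R * w)\<^sup>2) - b / (?R * w) + H (?R * w)) =
        Re (- a / (2 * w\<^sup>2) - ?R * b / w + ?R\<^sup>2 * H (?R * w))"
      by (metis scaleR_complex.sel(1) scaleR_conv_of_real of_real_power)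
    moreover have "ln (norm (?R * w)) = ln r + ln (norm w)"
      using r assms(2) by (simp add: norm_mult ln_mult)
    moreover have "c * ln (norm w) * r\<^sup>2 + c * (r\<^sup>2 * ln r) = r\<^sup>2 * (c * (ln r + ln (norm w)))"
      by (simp add: distrib_left)
    ultimately show "Re (- a / (2 * w\<^sup>2) - ?R * b / w + ?R\<^sup>2 * H (?R * w))
        + (c * ln (norm w) * r\<^sup>2 + c * (r\<^sup>2 * ln r)) = r\<^sup>2 * cubic_potential a b c H (?R * w)"
      unfolding cubic_potential_def distrib_left[of "r\<^sup>2"] by simp
  qed
  with lim show ?thesis by (rule Lim_transform_eventually)
qed

lemma reduced_003_not_proper:
  assumes red: "reduced_with_orders f (0, 0, 3)"
  shows "\<not> proper_end f"
proof
  assume proper: "proper_end f"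
  obtain \<phi> a b c h H where ce: "cubic_end f \<phi> a b c h H"
      and ord: "pole_order (\<lambda>z. \<phi> z $ 1) = 0" "pole_order (\<lambda>z. \<phi> z $ 2) = 0" "pole_order (\<lambda>z. \<phi> z $ 3) = 3"
    by (rule reduced_cubic_end[OF red order_refl])
  note f = cubic_endD(1)[OF ce] and forms = cubic_endD(2)[OF ce] and H = cubic_endD(3)[OF ce]
    and fk = cubic_endD(4)[OF ce]
  have abc: "a 1 = 0" "b 1 = 0" "c 1 = 0" "a 2 = 0" "b 2 = 0" "c 2 = 0" "a 3 \<noteq> 0"
    using pole_order_cubic_pole_form_iff(1)[OF forms[of 1]] pole_order_cubic_pole_form_iff(1)[OF forms[of 2]]
      pole_order_cubic_pole_form_iff(4)[OF forms[of 3]] ord by simp_all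
  have isH: "isCont (H k) 0" for k using H[of 0 k] DERIV_isCont by force
  \<comment> \<open>Near 0 the norms of \<open>H 1\<close> and \<open>H 2\<close> exceed their
    values at 0 by less than 1 each, whence the summand 2: a point where the third component
    vanishes has norm below \<open>B\<close>.\<close>
  define B where "B = norm (H 1 0) + norm (H 2 0) + 2"
  have near: "eventually (\<lambda>z. norm (H k z) < norm (H k 0) + 1) (at 0)" for k
    using isH[of k] tendsto_norm[of "H k" "H k 0" "at 0"] by (auto simp: isCont_def intro!: order_tendstoD(2))
  have "eventually (\<lambda>z. norm (f z) > B) (at 0)"
    using proper unfolding proper_end_def filterlim_at_top_dense by blast
  then have "eventually (\<lambda>z. norm (f z) > B \<and> norm (H 1 z) < norm (H 1 0) + 1 \<and> norm (H 2 z) < norm (H 2 0) + 1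
      \<and> z \<in> punctured_disk 1) (at 0)"
    using near[of 1] near[of 2] eventually_punctured_disk[of 1] by (simp add: eventually_conj_iff)
  then obtain d where d: "d > 0" "\<And>z. z \<noteq> 0 \<Longrightarrow> norm z < d \<Longrightarrow> norm (f z) > B \<and>
      norm (H 1 z) < norm (H 1 0) + 1 \<and> norm (H 2 z) < norm (H 2 0) + 1 \<and> z \<in> punctured_disk 1"
    unfolding eventually_at by auto
  \<comment> \<open>A unit vector whose square points opposite to \<open>a 3\<close>: the leading
    term \<open>- a 3 / (2 * z\<^sup>2)\<close> is positive along \<open>u\<close> and negative
    along \<open>\<i> * u\<close>.\<close>
  define u where "u = csqrt (- a 3 / of_real (norm (a 3)))"
  have u2: "u\<^sup>2 = - a 3 / of_real (norm (a 3))" by (simp add: u_def)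
  have "(norm u)\<^sup>2 = norm (u\<^sup>2)" by (simp add: norm_power)
  also have "\<dots> = 1" unfolding u2 using abc(7) by (simp add: norm_divide)
  finally have nu: "norm u = 1" using norm_ge_zero[of u] by (simp add: power2_eq_1_iff)
  then have u0: "u \<noteq> 0" by auto
  have val: "- a 3 / (2 * u\<^sup>2) = of_real (norm (a 3) / 2)" "- a 3 / (2 * (\<i> * u)\<^sup>2) = of_real (- norm (a 3) / 2)"
    using abc(7) by (simp_all add: u2 power_mult_distrib field_simps)
  have "eventually (\<lambda>r. r\<^sup>2 * cubic_potential (a 3) (b 3) (c 3) (H 3) (of_real r * u) > 0) (at_right 0)"
    by (rule order_tendstoD(1)[OF cubic_potential_ray[OF isH u0]]) (use abc(7) in \<open>simp only: val, simp\<close>)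
  moreover have "eventually (\<lambda>r. r\<^sup>2 * cubic_potential (a 3) (b 3) (c 3) (H 3) (of_real r * (\<i> * u)) < 0) (at_right 0)"
    by (rule order_tendstoD(2)[OF cubic_potential_ray[OF isH]], use u0 in simp)
      (use abc(7) in \<open>simp only: val, simp\<close>)
  moreover have "eventually (\<lambda>r. 0 < r \<and> r < d) (at_right 0)"
    using eventually_at_right[OF d(1)] d(1) by blast
  ultimately have "eventually (\<lambda>r. r\<^sup>2 * cubic_potential (a 3) (b 3) (c 3) (H 3) (of_real r * u) > 0 \<and>
     r\<^sup>2 * cubic_potential (a 3) (b 3) (c 3) (H 3) (of_real r * (\<i> * u)) < 0 \<and> 0 < r \<and> r < d) (at_right 0)"
    by (simp add: eventually_conj_iff)
  then obtain r where r: "0 < r" "r < d" "cubic_potential (a 3) (b 3) (c 3) (H 3) (of_real r * u) > 0"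
     "cubic_potential (a 3) (b 3) (c 3) (H 3) (of_real r * (\<i> * u)) < 0"
    using eventually_happens'[of "at_right (0::real)"] by (auto simp: zero_less_mult_iff mult_less_0_iff)
  have sph: "z \<in> punctured_disk 1" "z \<noteq> 0" "norm z < d" if "z \<in> sphere 0 r" for z :: complex
    using that r d(2)[of z] by auto
  have "continuous_on (sphere 0 r) (\<lambda>z. f z $ 3)"
    by (rule continuous_on_subset[OF end_continuous_on[OF f]]) (use sph in auto)
  then have "connected ((\<lambda>z. f z $ 3) ` sphere (0::complex) r)"
    by (intro connected_continuous_image connected_sphere) auto
  moreover have mem: "of_real r * u \<in> sphere 0 r" "of_real r * (\<i> * u) \<in> sphere 0 r"
    using r nu by (simp_all add: norm_mult)
  then have "f (of_real r * u) $ 3 > 0" "f (of_real r * (\<i> * u)) $ 3 < 0"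
    using r fk sph by auto
  ultimately have "0 \<in> (\<lambda>z. f z $ 3) ` sphere (0::complex) r"
    using mem connectedD_interval[of "(\<lambda>z. f z $ 3) ` sphere (0::complex) r" "f (of_real r * (\<i> * u)) $ 3" "f (of_real r * u) $ 3" 0]
    by auto
  then obtain z where z: "z \<in> sphere 0 r" "f z $ 3 = 0" by auto
  have "norm (f z) \<le> \<bar>f z $ 1\<bar> + \<bar>f z $ 2\<bar> + \<bar>f z $ 3\<bar>"
    using norm_le_l1_cart[of "f z"] by (simp add: sum_3)
  also have "\<dots> = \<bar>Re (H 1 z)\<bar> + \<bar>Re (H 2 z)\<bar>"
    using z(2) fk[OF sph(1)[OF z(1)]] abc by (simp add: cubic_potential_def)
  also have "\<dots> \<le> norm (H 1 z) + norm (H 2 z)" by (intro add_mono abs_Re_le_cmod)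
  also have "\<dots> < B" using d(2)[OF sph(2,3)[OF z(1)]] by (simp add: B_def)
  finally show False using d(2)[OF sph(2,3)[OF z(1)]] by simp
qed

section \<open>Ends of type (2,2,3)\<close>

text \<open>\<open>h\<close> may be unbounded on the open unit ball; compactness of the closed ball
  of radius 1/2 gives a bound, which is why later estimates live on
  \<open>punctured_disk (1/2)\<close>.\<close>

lemma primitive_lipschitz:
  assumes h: "h holomorphic_on ball 0 1"
    and H: "\<And>z. z \<in> ball 0 1 \<Longrightarrow> (H has_field_derivative h z) (at z)"
  obtains L where "L \<ge> 0" "\<And>z::complex. norm z \<le> 1/2 \<Longrightarrow> norm (h z) \<le> L"
    "\<And>z z'. norm z \<le> 1/2 \<Longrightarrow> norm z' \<le> 1/2 \<Longrightarrow> norm (H z - H z') \<le> L * norm (z - z')"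
proof -
  have "continuous_on (cball 0 (1/2)) h"
    by (rule continuous_on_subset[OF holomorphic_on_imp_continuous_on[OF h]]) auto
  then have "bounded (h ` cball 0 (1/2))"
    by (intro compact_imp_bounded compact_continuous_image) auto
  then obtain L where L: "L > 0" "\<And>z. z \<in> cball 0 (1/2) \<Longrightarrow> norm (h z) \<le> L"
    by (auto simp: bounded_pos)
  have "norm (H z - H z') \<le> L * norm (z - z')" if "norm z \<le> 1/2" "norm z' \<le> 1/2" for z z'
  proof (rule field_differentiable_bound[OF convex_cball])
    show "(H has_field_derivative h w) (at w within cball 0 (1/2))" if "w \<in> cball 0 (1/2)" for w
      using H[of w] that by (auto intro: has_field_derivative_at_within)
  qed (use L that in auto)
  then show ?thesis using that[of L] L by auto
qed

lemma abs_ln_norm_diff_le: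
  fixes z z' :: "'a::real_normed_vector"
  assumes "z' \<noteq> 0" "norm z' \<le> norm z"
  shows "\<bar>ln (norm z) - ln (norm z')\<bar> \<le> norm (z - z') / norm z'"
proof -
  have pos: "norm z' > 0" "norm z > 0" using assms by (simp, metis norm_le_zero_iff not_less order_trans zero_less_norm_iff)
  have "ln (norm z) - ln (norm z') = ln (norm z / norm z')" using pos by (simp add: ln_div)
  also have "\<dots> \<le> norm z / norm z' - 1" using pos by (intro ln_le_minus_one) auto
  also have "\<dots> = (norm z - norm z') / norm z'" using pos by (simp add: field_simps)
  also have "\<dots> \<le> norm (z - z') / norm z'"
    using pos norm_triangle_ineq2[of z z'] by (intro divide_right_mono) auto
  finally show ?thesis using assms pos by simp
qed

lemma norm_inverse_diff:
  fixes z z' :: complex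
  assumes "z \<noteq> 0" "z' \<noteq> 0"
  shows "norm (1 / z - 1 / z') = norm (z - z') / (norm z * norm z')"
proof -
  have "1 / z - 1 / z' = (z' - z) / (z * z')" using assms by (simp add: field_simps)
  then show ?thesis by (simp add: norm_divide norm_mult norm_minus_commute)
qed

text \<open>By symmetry \<open>z\<close> may be taken as the point of larger norm; then
  \<open>norm (z - z') / norm z' = norm z * norm (1 / z - 1 / z')\<close>, and
  \<open>norm z < r\<close> supplies the small factor.\<close>

lemma abs_ln_norm_diff_le_inverse:
  assumes "z \<in> punctured_disk r" "z' \<in> punctured_disk r"
  shows "\<bar>ln (norm z) - ln (norm z')\<bar> \<le> r * norm (1 / z - 1 / z')"
proof -
  have *: "\<bar>ln (norm z) - ln (norm z')\<bar> \<le> r * norm (1 / z - 1 / z')"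
    if "z \<in> punctured_disk r" "z' \<in> punctured_disk r" "norm z' \<le> norm z" for z z'
  proof -
    have z: "z \<noteq> 0" "z' \<noteq> 0" "norm z < r" using that by (auto simp: punctured_disk_iff)
    have "\<bar>ln (norm z) - ln (norm z')\<bar> \<le> norm (z - z') / norm z'"
      using abs_ln_norm_diff_le z that by blast
    also have "\<dots> = norm z * norm (1 / z - 1 / z')" using z by (simp add: norm_inverse_diff)
    also have "\<dots> \<le> r * norm (1 / z - 1 / z')" using z by (intro mult_right_mono) auto
    finally show ?thesis .
  qed
  show ?thesis
    using *[of z z'] *[of z' z] assms by (cases "norm z' \<le> norm z") (auto simp: norm_minus_commute abs_minus_commute)
qed

text \<open>With nothing more singular than the residue term, the Lipschitz constant in
  \<open>1 / z\<close> carries the factor \<open>r\<close> and can be made small. One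
  \<open>C\<close> serves all four bounds: this one for injectivity, that of the form for the
  immersion, the logarithmic size bound for properness and the coarser one for the square root
  argument.\<close>

lemma log_potential_lipschitz_inverse:
  assumes h: "h holomorphic_on ball 0 1"
    and H: "\<And>z. z \<in> ball 0 1 \<Longrightarrow> (H has_field_derivative h z) (at z)"
  obtains C where "C \<ge> 0"
    "\<And>r z z'. r \<le> 1/2 \<Longrightarrow> z \<in> punctured_disk r \<Longrightarrow> z' \<in> punctured_disk r \<Longrightarrow>
      \<bar>cubic_potential 0 0 c H z - cubic_potential 0 0 c H z'\<bar> \<le> C * r * norm (1 / z - 1 / z')"
    "\<And>z. z \<in> punctured_disk (1/2) \<Longrightarrow> norm (of_real c / z + h z) \<le> C / norm z"
    "\<And>z. z \<in> punctured_disk (1/2) \<Longrightarrow> \<bar>cubic_potential 0 0 c H z\<bar> \<le> C / norm z"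
    "\<And>z. z \<in> punctured_disk (1/2) \<Longrightarrow> \<bar>cubic_potential 0 0 c H z\<bar> \<le> C * (1 - ln (norm z))"
proof -
  obtain L where L: "L \<ge> 0" "\<And>z. norm z \<le> 1/2 \<Longrightarrow> norm (h z) \<le> L"
      "\<And>z z'. norm z \<le> 1/2 \<Longrightarrow> norm z' \<le> 1/2 \<Longrightarrow> norm (H z - H z') \<le> L * norm (z - z')"
    using primitive_lipschitz[OF h H] by blast
  define C where "C = \<bar>c\<bar> + L + norm (H 0)"
  have 1: "\<bar>cubic_potential 0 0 c H z - cubic_potential 0 0 c H z'\<bar> \<le> C * r * norm (1 / z - 1 / z')"
    if r: "r \<le> 1/2" and z: "z \<in> punctured_disk r" "z' \<in> punctured_disk r" for r z z'
  proof -
    have z0: "z \<noteq> 0" "z' \<noteq> 0" "norm z < r" "norm z' < r" using z by (auto simp: punctured_disk_iff)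
    then have r0: "r > 0" by (metis less_trans norm_ge_zero order_le_less_trans)
    have "\<bar>cubic_potential 0 0 c H z - cubic_potential 0 0 c H z'\<bar> =
        \<bar>c * (ln (norm z) - ln (norm z')) + Re (H z - H z')\<bar>"
      by (simp add: cubic_potential_def algebra_simps)
    also have "\<dots> \<le> \<bar>c\<bar> * \<bar>ln (norm z) - ln (norm z')\<bar> + norm (H z - H z')"
      using abs_Re_le_cmod[of "H z - H z'"] by (simp add: abs_mult[symmetric])
    also have "\<dots> \<le> \<bar>c\<bar> * (r * norm (1 / z - 1 / z')) + L * (r * norm (1 / z - 1 / z'))"
    proof (intro add_mono mult_left_mono abs_ln_norm_diff_le_inverse z)
      have "norm z * norm z' \<le> 1 * r" using z0 r by (intro mult_mono) auto
      then have "norm z * norm z' * norm (1 / z - 1 / z') \<le> r * norm (1 / z - 1 / z')"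
        by (intro mult_right_mono) auto
      then have "norm (z - z') \<le> r * norm (1 / z - 1 / z')"
        using z0 by (simp add: norm_inverse_diff)
      moreover have "norm (H z - H z') \<le> L * norm (z - z')" using L(3) z0 r by auto
      ultimately show "norm (H z - H z') \<le> L * (r * norm (1 / z - 1 / z'))"
        using L(1) by (meson mult_left_mono order_trans)
    qed auto
    also have "\<dots> = (\<bar>c\<bar> + L) * (r * norm (1 / z - 1 / z'))" by (simp add: distrib_right)
    also have "\<dots> \<le> C * (r * norm (1 / z - 1 / z'))"
      using r0 by (intro mult_right_mono) (auto simp: C_def)
    finally show ?thesis by (simp add: mult.assoc)
  qed
  have C0: "C \<ge> 0" using L by (simp add: C_def)
  have inv_ge: "1 \<le> 1 / norm z" if "z \<in> punctured_disk (1/2)" for z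
    using that by (simp add: punctured_disk_iff field_simps)
  have 2: "norm (of_real c / z + h z) \<le> C / norm z" if z: "z \<in> punctured_disk (1/2)" for z
  proof -
    have "norm (of_real c / z + h z) \<le> \<bar>c\<bar> * (1 / norm z) + L * 1"
      using L(2)[of z] z norm_triangle_ineq[of "of_real c / z" "h z"]
      by (simp add: punctured_disk_iff norm_divide)
    also have "\<dots> \<le> \<bar>c\<bar> * (1 / norm z) + L * (1 / norm z)"
      using inv_ge[OF z] L(1) by (intro add_left_mono mult_left_mono)
    also have "\<dots> = (\<bar>c\<bar> + L) * (1 / norm z)" by (simp only: distrib_right)
    also have "\<dots> \<le> C * (1 / norm z)"
      by (intro mult_right_mono) (auto simp: C_def)
    finally show ?thesis by simp
  qed
  have 4: "\<bar>cubic_potential 0 0 c H z\<bar> \<le> C * (1 - ln (norm z))" if z: "z \<in> punctured_disk (1/2)" for z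
  proof -
    have ln: "ln (norm z) \<le> 0" using z by (simp add: punctured_disk_iff)
    have "norm (H z) \<le> norm (H 0) + norm (H z - H 0)" by (rule norm_triangle_sub)
    also have "norm (H z - H 0) \<le> L * norm z" using L(3)[of z 0] z by (simp add: punctured_disk_iff)
    also have "L * norm z \<le> L * 1" using z L(1) by (intro mult_left_mono) (auto simp: punctured_disk_iff)
    finally have Hz: "norm (H z) \<le> norm (H 0) + L" by simp
    have "\<bar>cubic_potential 0 0 c H z\<bar> \<le> \<bar>Re (H z)\<bar> + \<bar>c\<bar> * \<bar>ln (norm z)\<bar>"
      by (simp add: cubic_potential_def abs_mult[symmetric])
    also have "\<dots> \<le> (norm (H 0) + L) + \<bar>c\<bar> * (- ln (norm z))"
      using Hz abs_Re_le_cmod[of "H z"] ln by simp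
    also have "\<dots> \<le> C * 1 + C * (- ln (norm z))"
      using ln L(1) by (intro add_mono mult_right_mono) (auto simp: C_def)
    finally show ?thesis by (simp add: algebra_simps)
  qed
  have 3: "\<bar>cubic_potential 0 0 c H z\<bar> \<le> C / norm z" if z: "z \<in> punctured_disk (1/2)" for z
  proof -
    have z0: "norm z > 0" using z by (simp add: punctured_disk_iff)
    have "ln (1 / norm z) \<le> 1 / norm z - 1" using z0 by (intro ln_le_minus_one) auto
    then have "1 - ln (norm z) \<le> 1 / norm z" using z0 by (simp add: ln_div)
    then have "C * (1 - ln (norm z)) \<le> C * (1 / norm z)" using C0 by (rule mult_left_mono)
    then show ?thesis using 4[OF z] by simp
  qed
  show ?thesis using that[OF C0] 1 2 3 4 by blast
qed

text \<open>Cramer's rule for the real linear system that recovers \<open>u\<close> from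
  \<open>Re (a * u)\<close> and \<open>Re (b * u)\<close>; its determinant is
  \<open>Im (a * cnj b)\<close>.\<close>

lemma real_parts_solve:
  "of_real (Im (a * cnj b)) * u = \<i> * (of_real (Re (b * u)) * cnj a - of_real (Re (a * u)) * cnj b)"
  by (simp add: complex_eq_iff algebra_simps)

lemma real_parts_lower_bound:
  assumes "Im (a * cnj b) \<noteq> 0"
  obtains \<delta> where "\<delta> > 0" "\<And>u. \<delta> * norm u \<le> \<bar>Re (a * u)\<bar> + \<bar>Re (b * u)\<bar>"
proof
  define D where "D = \<bar>Im (a * cnj b)\<bar>"
  define s where "s = norm a + norm b"
  have D: "D > 0" using assms by (simp add: D_def)
  have "a \<noteq> 0" using assms by auto
  then have s: "s > 0" by (simp add: s_def add_pos_nonneg)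
  show "D / s > 0" using D s by simp
  fix u :: complex
  have "D * norm u = norm (of_real (Im (a * cnj b)) * u)" by (simp only: D_def norm_mult norm_of_real)
  also have "\<dots> = norm (of_real (Re (b * u)) * cnj a - of_real (Re (a * u)) * cnj b)"
    unfolding real_parts_solve by (simp only: norm_mult norm_ii mult_1)
  also have "\<dots> \<le> \<bar>Re (b * u)\<bar> * norm a + \<bar>Re (a * u)\<bar> * norm b"
    using norm_triangle_ineq4[of "of_real (Re (b * u)) * cnj a" "of_real (Re (a * u)) * cnj b"]
    by (simp only: norm_mult norm_of_real complex_mod_cnj)
  also have "\<dots> \<le> \<bar>Re (b * u)\<bar> * s + \<bar>Re (a * u)\<bar> * s"
    by (intro add_mono mult_left_mono) (auto simp: s_def)
  finally have "D * norm u \<le> (\<bar>Re (a * u)\<bar> + \<bar>Re (b * u)\<bar>) * s" by (simp only: distrib_right add.commute)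
  then show "D / s * norm u \<le> \<bar>Re (a * u)\<bar> + \<bar>Re (b * u)\<bar>"
    using s by (simp add: field_simps)
qed

lemma filterlim_norm_at_right_0: "filterlim norm (at_right 0) (at (0::complex))"
proof -
  have "eventually (\<lambda>z::complex. norm z \<in> {0<..}) (at 0)"
    unfolding eventually_at by (intro exI[of _ 1]) auto
  moreover have "(norm \<longlongrightarrow> 0) (at (0::complex))" by (rule tendsto_norm_zero) (rule tendsto_ident_at)
  ultimately show ?thesis by (simp add: filterlim_at eventually_conj_iff)
qed

lemma reduced_223_properly_embedded:
  assumes red: "reduced_with_orders f (2, 2, 3)"
  shows "properly_embedded f"
proof -
  obtain \<phi> a b c h H where ce: "cubic_end f \<phi> a b c h H"
      and ord: "pole_order (\<lambda>z. \<phi> z $ 1) = 2" "pole_order (\<lambda>z. \<phi> z $ 2) = 2" "pole_order (\<lambda>z. \<phi> z $ 3) = 3"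
    by (rule reduced_cubic_end[OF red order_refl])
  note f = cubic_endD(1)[OF ce] and forms = cubic_endD(2)[OF ce] and H = cubic_endD(3)[OF ce]
    and fk = cubic_endD(4)[OF ce]
  note ab = reduced_223_first_pair_independent[OF red f ord(1,2) forms]
  have hol: "h k holomorphic_on ball 0 1" for k using forms[of k] by (simp add: cubic_pole_form_def)
  obtain \<delta> where \<delta>: "\<delta> > 0" "\<And>u. \<delta> * norm u \<le> \<bar>Re (b 1 * u)\<bar> + \<bar>Re (b 2 * u)\<bar>"
    using real_parts_lower_bound[OF ab(3)] by blast
  define g where "g k = cubic_potential 0 0 (c k) (H k)" for k
  have "\<exists>C\<ge>0. (\<forall>r z z'. r \<le> 1/2 \<longrightarrow> z \<in> punctured_disk r \<longrightarrow> z' \<in> punctured_disk r \<longrightarrow>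
      \<bar>g k z - g k z'\<bar> \<le> C * r * norm (1 / z - 1 / z')) \<and>
    (\<forall>z\<in>punctured_disk (1/2). norm (of_real (c k) / z + h k z) \<le> C / norm z \<and>
      \<bar>g k z\<bar> \<le> C * (1 - ln (norm z)))" for k
    unfolding g_def by (rule log_potential_lipschitz_inverse[OF hol[of k] H[where k = k], where c = "c k"]) blast+
  then obtain C where C: "\<And>k. C k \<ge> 0"
      and glip: "\<And>k r z z'. r \<le> 1/2 \<Longrightarrow> z \<in> punctured_disk r \<Longrightarrow> z' \<in> punctured_disk r \<Longrightarrow>
        \<bar>g k z - g k z'\<bar> \<le> C k * r * norm (1 / z - 1 / z')"
      and hbd: "\<And>k z. z \<in> punctured_disk (1/2) \<Longrightarrow> norm (of_real (c k) / z + h k z) \<le> C k / norm z"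
      and gbd: "\<And>k z. z \<in> punctured_disk (1/2) \<Longrightarrow> \<bar>g k z\<bar> \<le> C k * (1 - ln (norm z))"
    by metis
  have fg: "f z $ k = g k z - Re (b k * (1 / z))" if "z \<in> punctured_disk 1" "k = 1 \<or> k = 2" for z k
    using fk[OF that(1), of k] ab(1,2) that(2) by (auto simp: g_def cubic_potential_def)
  define K where "K = C 1 + C 2"
  have K0: "K \<ge> 0" using C by (simp add: K_def)
  \<comment> \<open>The perturbation has Lipschitz constant \<open>K * r\<close>, to be kept below
    the lower bound \<open>\<delta>\<close> of the linear part; the summand 1 covers
    \<open>K = 0\<close>.\<close>
  define r where "r = min (1/2) (\<delta> / (2 * (K + 1)))"
  have "r \<le> 1/2" unfolding r_def by (rule min.cobounded1)
  moreover have "0 < r" using \<delta>(1) K0 by (simp add: r_def)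
  ultimately have r: "0 < r" "r \<le> 1/2" by simp_all
  have Kr: "K * r < \<delta>"
  proof -
    have "K * r \<le> K * (\<delta> / (2 * (K + 1)))" using K0 by (intro mult_left_mono) (auto simp: r_def)
    also have "\<dots> < \<delta>" using K0 \<delta>(1) by (simp add: field_simps add_nonneg_pos)
    finally show ?thesis .
  qed
  have sub1: "punctured_disk r \<subseteq> punctured_disk 1" and sub2: "punctured_disk r \<subseteq> punctured_disk (1/2)"
    using r by (auto simp: punctured_disk_iff)
  \<comment> \<open>Applied with \<open>u = 1 / z - 1 / z'\<close> for injectivity and with
    \<open>u = v / z ^ 2\<close> for the immersion, the latter being, up to sign, the image of
    \<open>v\<close> under the differential of \<open>1 / z\<close>.\<close>
  have small: "u = 0" if "\<bar>Re (b 1 * u)\<bar> \<le> C 1 * r * norm u" "\<bar>Re (b 2 * u)\<bar> \<le> C 2 * r * norm u" for u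
  proof (rule ccontr)
    assume "u \<noteq> 0"
    have "\<delta> * norm u \<le> (K * r) * norm u"
      using \<delta>(2)[of u] that by (simp add: K_def distrib_right)
    then show False using Kr \<open>u \<noteq> 0\<close> by simp
  qed
  have "inj_on f (punctured_disk r)"
  proof (rule inj_onI)
    fix z z' assume z: "z \<in> punctured_disk r" "z' \<in> punctured_disk r" and eq: "f z = f z'"
    have z1: "z \<in> punctured_disk 1" "z' \<in> punctured_disk 1" using z sub1 by auto
    have "\<bar>Re (b k * (1 / z - 1 / z'))\<bar> \<le> C k * r * norm (1 / z - 1 / z')" if "k = 1 \<or> k = 2" for k
    proof -
      have "Re (b k * (1 / z - 1 / z')) = Re (b k * (1 / z)) - Re (b k * (1 / z'))"
        by (simp only: right_diff_distrib minus_complex.sel)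
      also have "\<dots> = g k z - g k z'" using fg[OF z1(1) that] fg[OF z1(2) that] eq by simp
      finally show ?thesis using glip[OF r(2) z] by simp
    qed
    then have "1 / z - 1 / z' = 0" by (intro small) auto
    then show "z = z'" by simp
  qed
  moreover have "immersion_on f (punctured_disk r)"
  proof (rule end_immersion_onI[OF f sub1])
    fix z v assume z: "z \<in> punctured_disk r" and v: "\<And>k. Re (\<phi> z $ k * v) = 0"
    have z0: "z \<noteq> 0" "norm z < r" using z by (auto simp: punctured_disk_iff)
    define u where "u = v / z ^ 2"
    have "\<bar>Re (b k * u)\<bar> \<le> C k * r * norm u" if "k = 1 \<or> k = 2" for k
    proof -
      have "\<phi> z $ k = b k / z ^ 2 + (of_real (c k) / z + h k z)"
        using forms[of k] z sub1 ab(1,2) that by (auto simp: cubic_pole_form_def)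
      then have "\<phi> z $ k * v = b k * u + (of_real (c k) / z + h k z) * v"
        by (simp add: u_def algebra_simps)
      then have "Re (b k * u) = - Re ((of_real (c k) / z + h k z) * v)"
        using v[of k] by (metis add_eq_0_iff plus_complex.sel(1) add.commute)
      then have "\<bar>Re (b k * u)\<bar> \<le> norm ((of_real (c k) / z + h k z) * v)"
        using abs_Re_le_cmod[of "(of_real (c k) / z + h k z) * v"] by linarith
      also have "\<dots> \<le> C k / norm z * norm v"
        unfolding norm_mult using hbd z sub2 by (intro mult_right_mono) auto
      also have "\<dots> = C k * norm z * norm u"
        using z0 by (simp add: u_def norm_divide norm_mult power2_eq_square)
      also have "\<dots> \<le> C k * r * norm u"
        using z0 C[of k] by (intro mult_right_mono mult_left_mono) auto
      finally show ?thesis .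
    qed
    then have "u = 0" by (intro small) auto
    then show "v = 0" using z0 by (simp add: u_def)
  qed
  moreover have "proper_end f"
  proof -
    \<comment> \<open>The linear part grows like \<open>\<delta> / norm z\<close>, the perturbation
      only logarithmically; the division by 2 comes from bounding each of two components by
      \<open>norm (f z)\<close>.\<close>
    have lower: "(\<delta> / norm z - K * (1 - ln (norm z))) / 2 \<le> norm (f z)" if z: "z \<in> punctured_disk (1/2)" for z
    proof -
      have z1: "z \<in> punctured_disk 1" using z by (auto simp: punctured_disk_iff)
      have "\<delta> / norm z = \<delta> * norm (1 / z)" by (simp add: norm_divide)
      also have "\<dots> \<le> \<bar>Re (b 1 * (1 / z))\<bar> + \<bar>Re (b 2 * (1 / z))\<bar>" by (rule \<delta>)
      also have "\<dots> \<le> (\<bar>f z $ 1\<bar> + \<bar>g 1 z\<bar>) + (\<bar>f z $ 2\<bar> + \<bar>g 2 z\<bar>)"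
        using fg[OF z1, of 1] fg[OF z1, of 2] by simp
      also have "\<dots> \<le> (norm (f z) + C 1 * (1 - ln (norm z))) + (norm (f z) + C 2 * (1 - ln (norm z)))"
        using component_le_norm_cart[of "f z"] gbd[OF z] by (intro add_mono) auto
      finally show ?thesis by (simp add: K_def algebra_simps)
    qed
    have "filterlim (\<lambda>x::real. (\<delta> / x - K * (1 - ln x)) / 2) at_top (at_right 0)"
      using \<delta>(1) K0 by (cases "K = 0"; real_asymp)
    then have "filterlim (\<lambda>z::complex. (\<delta> / norm z - K * (1 - ln (norm z))) / 2) at_top (at 0)"
      by (rule filterlim_compose[OF _ filterlim_norm_at_right_0])
    then show ?thesis
      unfolding proper_end_def
    proof (rule filterlim_at_top_mono)
      show "eventually (\<lambda>z. (\<delta> / norm z - K * (1 - ln (norm z))) / 2 \<le> norm (f z)) (at 0)"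
        using eventually_punctured_disk[of "1/2"] by (rule eventually_mono) (use lower in auto)
    qed
  qed
  ultimately show ?thesis
    unfolding properly_embedded_def using r by (intro conjI exI[of _ r]) auto
qed

section \<open>Two components of top order\<close>

text \<open>For \<open>norm z' \<le> norm z\<close> the difference is split so that
  \<open>S z - S z'\<close> gets the smaller factor \<open>z'\<^sup>2\<close>, which absorbs the
  singular bound and also any value of \<open>S\<close> at 0. The two pieces contribute
  \<open>2 * M\<close> and \<open>M\<close>.\<close>

lemma square_times_lipschitz:
  fixes S :: "complex \<Rightarrow> complex"
  assumes M: "M \<ge> 0"
    and bd: "\<And>z. z \<in> punctured_disk (1/2) \<Longrightarrow> norm (S z) \<le> M / norm z"
    and lip: "\<And>z z'. z \<in> punctured_disk (1/2) \<Longrightarrow> z' \<in> punctured_disk (1/2) \<Longrightarrow>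
      norm (S z - S z') \<le> M * norm (1 / z - 1 / z')"
    and z: "z \<in> ball 0 (1/2)" "z' \<in> ball 0 (1/2)"
  shows "norm (z\<^sup>2 * S z - z'\<^sup>2 * S z') \<le> 3 * M * norm (z - z')"
proof -
  have *: "norm (z\<^sup>2 * S z - z'\<^sup>2 * S z') \<le> 3 * M * norm (z - z')"
    if z: "z \<in> ball 0 (1/2)" "z' \<in> ball 0 (1/2)" and le: "norm z' \<le> norm z" for z z'
  proof (cases "z = z'")
    case False
    then have z0: "z \<noteq> 0" using le by auto
    then have zp: "z \<in> punctured_disk (1/2)" using z by (simp add: punctured_disk_iff)
    have 1: "norm ((z\<^sup>2 - z'\<^sup>2) * S z) \<le> 2 * M * norm (z - z')"
    proof -
      have "z\<^sup>2 - z'\<^sup>2 = (z - z') * (z + z')" by (simp add: power2_eq_square algebra_simps)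
      then have "norm ((z\<^sup>2 - z'\<^sup>2) * S z) = norm (z - z') * (norm (z + z') * norm (S z))"
        by (simp add: norm_mult)
      also have "\<dots> \<le> norm (z - z') * ((2 * norm z) * (M / norm z))"
        using norm_triangle_ineq[of z z'] le bd[OF zp] by (intro mult_left_mono mult_mono) auto
      also have "\<dots> = 2 * M * norm (z - z')" using z0 by simp
      finally show ?thesis .
    qed
    have 2: "norm (z'\<^sup>2 * (S z - S z')) \<le> M * norm (z - z')"
    proof (cases "z' = 0")
      case False
      then have zp': "z' \<in> punctured_disk (1/2)" using z by (simp add: punctured_disk_iff)
      have "norm (z'\<^sup>2 * (S z - S z')) \<le> (norm z')\<^sup>2 * (M * norm (1 / z - 1 / z'))"
        unfolding norm_mult norm_power using lip[OF zp zp'] by (intro mult_left_mono) auto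
      also have "\<dots> = (norm z' / norm z) * (M * norm (z - z'))"
        using z0 False by (simp add: norm_inverse_diff power2_eq_square)
      also have "\<dots> \<le> 1 * (M * norm (z - z'))"
        using le z0 M by (intro mult_right_mono) auto
      finally show ?thesis by simp
    qed (use M in simp)
    have "z\<^sup>2 * S z - z'\<^sup>2 * S z' = (z\<^sup>2 - z'\<^sup>2) * S z + z'\<^sup>2 * (S z - S z')"
      by (simp add: algebra_simps)
    then show ?thesis
      using norm_triangle_ineq[of "(z\<^sup>2 - z'\<^sup>2) * S z" "z'\<^sup>2 * (S z - S z')"] 1 2 by simp
  qed simp
  show ?thesis
    using *[OF z] *[OF z(2,1)] by (cases "norm z' \<le> norm z") (auto simp: norm_minus_commute)
qed

text \<open>With \<open>v z = z\<^sup>2 * S z\<close> small and Lipschitz,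
  \<open>1 / z\<^sup>2 + S z = (1 + v z) / z\<^sup>2\<close>, so
  \<open>t z = z / csqrt (1 + v z)\<close> is a solution. As \<open>S\<close> is merely Lipschitz in
  \<open>1 / z\<close>, injectivity of \<open>t\<close> comes from \<open>t\<close> minus the
  identity having Lipschitz constant 1/2.\<close>

lemma double_cover_square_root:
  fixes S :: "complex \<Rightarrow> complex"
  assumes M: "M \<ge> 0"
    and bd: "\<And>z. z \<in> punctured_disk (1/2) \<Longrightarrow> norm (S z) \<le> M / norm z"
    and lip: "\<And>z z'. z \<in> punctured_disk (1/2) \<Longrightarrow> z' \<in> punctured_disk (1/2) \<Longrightarrow>
      norm (S z - S z') \<le> M * norm (1 / z - 1 / z')"
    and r: "r > 0"
  obtains \<rho> t where "0 < \<rho>" "\<rho> \<le> r" "\<rho> \<le> 1/2" "t 0 = 0" "continuous_on (ball 0 \<rho>) t" "inj_on t (ball 0 \<rho>)"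
    "\<And>z. z \<in> punctured_disk \<rho> \<Longrightarrow> 1 / z\<^sup>2 + S z = 1 / (t z)\<^sup>2"
proof -
  define v where "v z = z\<^sup>2 * S z" for z
  define \<psi> where "\<psi> w = 1 / csqrt (1 + w)" for w
  define K where "K = 3 * M"
  have K: "K \<ge> 0" using M by (simp add: K_def)
  have vlip: "norm (v z - v z') \<le> K * norm (z - z')" if "z \<in> ball 0 (1/2)" "z' \<in> ball 0 (1/2)" for z z'
    using square_times_lipschitz[OF M bd lip that] by (simp add: v_def K_def)
  have vbd: "norm (v z) \<le> K * norm z" if "z \<in> ball 0 (1/2)" for z
    using vlip[OF that, of 0] by (simp add: v_def)
  have \<psi>hol: "\<psi> holomorphic_on ball 0 1"
  proof -
    have "1 + w \<notin> \<real>\<^sub>\<le>\<^sub>0" if "norm w < 1" for w :: complex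
    proof -
      have "Re w > -1" using that abs_Re_le_cmod[of w] by linarith
      then show ?thesis by (auto simp: complex_nonpos_Reals_iff)
    qed
    moreover from this have "1 + w \<noteq> 0" if "norm w < 1" for w :: complex using that by fastforce
    ultimately show ?thesis unfolding \<psi>_def by (auto intro!: holomorphic_intros)
  qed
  obtain C where C: "C \<ge> 0" "\<And>w. norm w \<le> 1/2 \<Longrightarrow> norm (deriv \<psi> w) \<le> C"
      "\<And>w w'. norm w \<le> 1/2 \<Longrightarrow> norm w' \<le> 1/2 \<Longrightarrow> norm (\<psi> w - \<psi> w') \<le> C * norm (w - w')"
    using primitive_lipschitz[OF holomorphic_deriv[OF \<psi>hol open_ball], of \<psi>]
      holomorphic_derivI[OF \<psi>hol open_ball, of _ UNIV] by auto
  \<comment> \<open>Chosen so that \<open>C * K * \<rho>\<close> and \<open>K * \<rho>\<close> are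
    at most 1/4: the first gives the two quarters in \<open>near_id\<close>, the second keeps
    \<open>v\<close> in the disk of radius 1/2 where \<open>C\<close> bounds the derivative of
    \<open>\<psi>\<close>.\<close>
  define \<rho> where "\<rho> = min r (min (1/2) (1 / (4 * (C + 1) * (K + 1))))"
  define t where "t z = z * \<psi> (v z)" for z
  have \<rho>pos: "\<rho> > 0" using r C(1) K by (simp add: \<rho>_def)
  have \<rho>le: "\<rho> \<le> r" "\<rho> \<le> 1/2" "\<rho> \<le> 1 / (4 * (C + 1) * (K + 1))"
    unfolding \<rho>_def by (simp_all only: min.cobounded1 min.coboundedI2 min.cobounded2)
  have "\<rho> * (4 * (C + 1) * (K + 1)) \<le> 1"
    using \<rho>le(3) C(1) K by (simp add: pos_le_divide_eq)
  moreover have "\<rho> * (4 * C * K) \<le> \<rho> * (4 * (C + 1) * (K + 1))" "\<rho> * (4 * 1 * K) \<le> \<rho> * (4 * (C + 1) * (K + 1))"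
    using \<rho>pos C(1) K by (intro mult_left_mono mult_mono; simp)+
  ultimately have small: "C * K * \<rho> \<le> 1/4" "K * \<rho> \<le> 1/4" by (simp_all add: mult_ac)
  have in_half: "z \<in> ball 0 (1/2)" if "z \<in> ball 0 \<rho>" for z :: complex using that \<rho>le(2) by auto
  have v_small: "norm (v z) \<le> 1/4" "norm (v z) \<le> K * \<rho>" if "z \<in> ball 0 \<rho>" for z
  proof -
    have "norm (v z) \<le> K * norm z" using vbd in_half that by blast
    also have "\<dots> \<le> K * \<rho>" using that K by (intro mult_left_mono) auto
    finally show "norm (v z) \<le> K * \<rho>" .
    then show "norm (v z) \<le> 1/4" using small(2) by linarith
  qed
  have near_id: "norm ((t z - t z') - (z - z')) \<le> norm (z - z') / 2" if "z \<in> ball 0 \<rho>" "z' \<in> ball 0 \<rho>" for z z' :: complex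
  proof -
    have "norm (\<psi> (v z) - 1) = norm (\<psi> (v z) - \<psi> 0)" by (simp add: \<psi>_def)
    also have "\<dots> \<le> C * norm (v z - 0)" by (rule C(3)) (use v_small(1)[OF that(1)] in auto)
    also have "\<dots> \<le> C * (K * \<rho>)" using v_small(2)[OF that(1)] C(1) by (intro mult_left_mono) auto
    finally have 1: "norm (\<psi> (v z) - 1) \<le> 1/4" using small(1) by (simp add: mult.assoc)
    have "norm (\<psi> (v z) - \<psi> (v z')) \<le> C * norm (v z - v z')"
      by (rule C(3)) (use v_small(1)[OF that(1)] v_small(1)[OF that(2)] in auto)
    also have "\<dots> \<le> C * (K * norm (z - z'))"
      using vlip in_half that C(1) by (intro mult_left_mono) auto
    finally have "norm z' * norm (\<psi> (v z) - \<psi> (v z')) \<le> \<rho> * (C * (K * norm (z - z')))"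
      using that \<rho>pos by (intro mult_mono) auto
    also have "\<dots> = (C * K * \<rho>) * norm (z - z')" by (simp add: mult_ac)
    also have "\<dots> \<le> 1/4 * norm (z - z')" using small(1) by (intro mult_right_mono) auto
    finally have 2: "norm (z' * (\<psi> (v z) - \<psi> (v z'))) \<le> 1/4 * norm (z - z')" by (simp add: norm_mult)
    have "(t z - t z') - (z - z') = (z - z') * (\<psi> (v z) - 1) + z' * (\<psi> (v z) - \<psi> (v z'))"
      by (simp add: t_def algebra_simps)
    then have "norm ((t z - t z') - (z - z')) \<le> norm ((z - z') * (\<psi> (v z) - 1)) + norm (z' * (\<psi> (v z) - \<psi> (v z')))"
      by (simp only: norm_triangle_ineq)
    also have "norm ((z - z') * (\<psi> (v z) - 1)) \<le> norm (z - z') * (1/4)"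
      unfolding norm_mult using 1 by (intro mult_left_mono) auto
    finally show ?thesis using 2 by simp
  qed
  have "inj_on t (ball 0 \<rho>)"
  proof (rule inj_onI)
    fix z z' :: complex assume "z \<in> ball 0 \<rho>" "z' \<in> ball 0 \<rho>" "t z = t z'"
    then have "norm (z - z') \<le> norm (z - z') / 2" using near_id[of z z'] by (simp add: norm_minus_commute)
    then show "z = z'" by simp
  qed
  moreover have "continuous_on (ball 0 \<rho>) t"
  proof -
    have "2-lipschitz_on (ball 0 \<rho>) t"
    proof (rule lipschitz_onI)
      fix z z' :: complex assume "z \<in> ball 0 \<rho>" "z' \<in> ball 0 \<rho>"
      then have "norm (t z - t z') \<le> 2 * norm (z - z')"
        using near_id[of z z'] norm_triangle_sub[of "t z - t z'" "z - z'"] norm_ge_zero[of "z - z'"] by linarith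
      then show "dist (t z) (t z') \<le> 2 * dist z z'" by (simp add: dist_norm)
    qed simp
    then show ?thesis by (rule lipschitz_on_continuous_on)
  qed
  moreover have "1 / z\<^sup>2 + S z = 1 / (t z)\<^sup>2" if "z \<in> punctured_disk \<rho>" for z
  proof -
    have z: "z \<noteq> 0" "z \<in> ball 0 \<rho>" using that by (auto simp: punctured_disk_def)
    have "1 + v z \<noteq> 0" using v_small(1)[OF z(2)] by (metis add_eq_0_iff norm_minus_cancel norm_one not_le one_less_numeral_iff semiring_norm(76) divide_less_eq_1_pos zero_less_numeral)
    then have "1 / (t z)\<^sup>2 = (1 + v z) / z\<^sup>2"
      by (simp add: t_def \<psi>_def power_mult_distrib power_divide)
    also have "\<dots> = 1 / z\<^sup>2 + S z" using z by (simp add: v_def field_simps)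
    finally show ?thesis by simp
  qed
  ultimately show ?thesis using that[of \<rho> t] \<rho>pos \<rho>le by (simp add: t_def)
qed

text \<open>The image of \<open>t\<close> is open by invariance of domain, so it contains a circle
  around 0, and the inverse of \<open>t\<close> carries this circle back continuously. Opposite
  points have the same square, hence the same planar value.\<close>

lemma double_cover_coincidence:
  fixes S :: "complex \<Rightarrow> complex" and F :: "complex \<Rightarrow> real"
  assumes M: "M \<ge> 0"
    and bd: "\<And>z. z \<in> punctured_disk (1/2) \<Longrightarrow> norm (S z) \<le> M / norm z"
    and lip: "\<And>z z'. z \<in> punctured_disk (1/2) \<Longrightarrow> z' \<in> punctured_disk (1/2) \<Longrightarrow>
      norm (S z - S z') \<le> M * norm (1 / z - 1 / z')"
    and F: "continuous_on (punctured_disk 1) F" and r: "r > 0"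
  obtains z z' where "z \<in> punctured_disk r" "z' \<in> punctured_disk r" "z \<noteq> z'"
    "1 / z\<^sup>2 + S z = 1 / z'\<^sup>2 + S z'" "F z = F z'"
proof -
  obtain \<rho> t where \<rho>: "0 < \<rho>" "\<rho> \<le> r" "\<rho> \<le> 1/2" and t: "t 0 = 0" "continuous_on (ball 0 \<rho>) t" "inj_on t (ball 0 \<rho>)"
      "\<And>z. z \<in> punctured_disk \<rho> \<Longrightarrow> 1 / z\<^sup>2 + S z = 1 / (t z)\<^sup>2"
    using double_cover_square_root[OF M bd lip r] by blast
  have "open (t ` ball 0 \<rho>)" by (rule invariance_of_domain[OF t(2) open_ball t(3)])
  moreover have "0 \<in> t ` ball 0 \<rho>" using t(1) \<rho>(1) by (metis centre_in_ball imageI)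
  ultimately obtain \<epsilon> where \<epsilon>: "\<epsilon> > 0" "cball 0 \<epsilon> \<subseteq> t ` ball 0 \<rho>"
    by (meson open_contains_cball)
  obtain g where g: "homeomorphism (ball 0 \<rho>) (t ` ball 0 \<rho>) t g"
    using invariance_of_domain_homeomorphism[OF open_ball t(2) _ t(3)] by auto
  define w where "w \<theta> = of_real \<epsilon> * cis \<theta>" for \<theta>
  have w: "w \<theta> \<in> t ` ball 0 \<rho>" "w \<theta> \<noteq> 0" for \<theta>
    using \<epsilon> by (auto simp: w_def norm_mult)
  have gw: "t (g (w \<theta>)) = w \<theta>" "g (w \<theta>) \<in> punctured_disk \<rho>" for \<theta>
  proof -
    show "t (g (w \<theta>)) = w \<theta>" using homeomorphism_apply2[OF g w(1)] .
    moreover have "g (w \<theta>) \<in> ball 0 \<rho>" using homeomorphism_image2[OF g] w(1) by blast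
    ultimately show "g (w \<theta>) \<in> punctured_disk \<rho>" using t(1) w(2) by (auto simp: punctured_disk_def)
  qed
  have w_pi: "w (\<theta> + pi) = - w \<theta>" for \<theta> by (simp add: w_def complex_eq_iff)
  have "continuous_on UNIV w" unfolding w_def by (intro continuous_intros)
  then have "continuous_on UNIV (\<lambda>\<theta>. g (w \<theta>))"
    by (rule continuous_on_compose2[OF homeomorphism_cont2[OF g]]) (use w in auto)
  moreover have "g (w \<theta>) \<in> punctured_disk 1" for \<theta>
    using gw(2)[of \<theta>] \<rho>(3) by (simp add: punctured_disk_iff)
  ultimately have contF: "continuous_on UNIV (\<lambda>\<theta>. F (g (w \<theta>)))"
    by (intro continuous_on_compose2[OF F]) auto
  \<comment> \<open>Difference between antipodal points of the circle; a half turn changes its sign,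
    so it has a zero on \<open>{0..pi}\<close>.\<close>
  define D where "D \<theta> = F (g (w \<theta>)) - F (g (w (\<theta> + pi)))" for \<theta>
  have contD: "continuous_on {0..pi} D"
    unfolding D_def
    by (intro continuous_on_diff continuous_on_compose2[OF contF] continuous_intros) auto
  have "D pi = - D 0" unfolding D_def w_pi using w_pi[of 0] by simp
  then consider "D 0 \<le> 0" "0 \<le> D pi" | "D pi \<le> 0" "0 \<le> D 0" by linarith
  then have "\<exists>\<theta>. D \<theta> = 0"
  proof cases
    case 1
    then show ?thesis using IVT'[OF 1 pi_ge_zero contD] by blast
  next
    case 2
    then show ?thesis using IVT2'[OF 2 pi_ge_zero contD] by blast
  qed
  then obtain \<theta> where \<theta>: "F (g (w \<theta>)) = F (g (- w \<theta>))" by (auto simp: D_def w_pi)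
  show ?thesis
  proof (rule that)
    show "F (g (w \<theta>)) = F (g (- w \<theta>))" by (rule \<theta>)
    show "g (w \<theta>) \<in> punctured_disk r" "g (- w \<theta>) \<in> punctured_disk r"
      using gw(2)[of \<theta>] gw(2)[of "\<theta> + pi"] \<rho>(2) unfolding w_pi by (auto simp: punctured_disk_iff)
    have tm: "t (g (- w \<theta>)) = - w \<theta>" using gw(1)[of "\<theta> + pi"] unfolding w_pi .
    then show "g (w \<theta>) \<noteq> g (- w \<theta>)" using gw(1)[of \<theta>] w(2)[of \<theta>] by auto
    show "1 / (g (w \<theta>))\<^sup>2 + S (g (w \<theta>)) = 1 / (g (- w \<theta>))\<^sup>2 + S (g (- w \<theta>))"
      using t(4)[OF gw(2)[of \<theta>]] t(4)[OF gw(2)[of "\<theta> + pi"]] gw(1)[of \<theta>] tm unfolding w_pi by simp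
  qed
qed

text \<open>The term \<open>b / z\<close> is linear in \<open>1 / z\<close> and costs
  \<open>norm b\<close>. The constant no longer shrinks with the radius; smallness is regained by
  the multiplication with \<open>z\<^sup>2\<close> in \<open>square_times_lipschitz\<close>.\<close>

lemma pole_potential_lipschitz_inverse:
  assumes h: "h holomorphic_on ball 0 1"
    and H: "\<And>z. z \<in> ball 0 1 \<Longrightarrow> (H has_field_derivative h z) (at z)"
  obtains C where "C \<ge> 0"
    "\<And>z z'. z \<in> punctured_disk (1/2) \<Longrightarrow> z' \<in> punctured_disk (1/2) \<Longrightarrow>
      \<bar>cubic_potential 0 b c H z - cubic_potential 0 b c H z'\<bar> \<le> C * norm (1 / z - 1 / z')"
    "\<And>z. z \<in> punctured_disk (1/2) \<Longrightarrow> \<bar>cubic_potential 0 b c H z\<bar> \<le> C / norm z"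
proof -
  obtain C where C: "C \<ge> 0"
    "\<And>r z z'. r \<le> 1/2 \<Longrightarrow> z \<in> punctured_disk r \<Longrightarrow> z' \<in> punctured_disk r \<Longrightarrow>
      \<bar>cubic_potential 0 0 c H z - cubic_potential 0 0 c H z'\<bar> \<le> C * r * norm (1 / z - 1 / z')"
    "\<And>z. z \<in> punctured_disk (1/2) \<Longrightarrow> \<bar>cubic_potential 0 0 c H z\<bar> \<le> C / norm z"
    by (rule log_potential_lipschitz_inverse[OF h H, where c = c]) (assumption | rule that | blast)+
  have split: "cubic_potential 0 b c H z = cubic_potential 0 0 c H z - Re (b * (1 / z))" for z
    by (simp add: cubic_potential_def)
  have Re_le: "\<bar>Re (b * u)\<bar> \<le> norm b * norm u" for u
    using abs_Re_le_cmod[of "b * u"] by (simp add: norm_mult)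
  show ?thesis
  proof (rule that)
    show "0 \<le> C + norm b" using C(1) by simp
    fix z assume z: "z \<in> punctured_disk (1/2)"
    show "\<bar>cubic_potential 0 b c H z\<bar> \<le> (C + norm b) / norm z"
      using C(3)[OF z] Re_le[of "1 / z"] unfolding split add_divide_distrib by (simp add: norm_divide)
    fix z' assume z': "z' \<in> punctured_disk (1/2)"
    have "C * (1/2) * norm (1 / z - 1 / z') \<le> C * norm (1 / z - 1 / z')"
      using C(1) by (intro mult_right_mono) auto
    moreover have "Re (b * (1 / z)) - Re (b * (1 / z')) = Re (b * (1 / z - 1 / z'))"
      by (simp only: right_diff_distrib minus_complex.sel)
    ultimately show "\<bar>cubic_potential 0 b c H z - cubic_potential 0 b c H z'\<bar> \<le> (C + norm b) * norm (1 / z - 1 / z')"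
      using C(2)[OF order_refl z z'] Re_le[of "1 / z - 1 / z'"] unfolding split distrib_right by linarith
  qed
qed

lemma real_parts_injective:
  assumes "Im (a * cnj b) \<noteq> 0" "of_real y * cnj a - of_real x * cnj b = 0"
  shows "x = 0 \<and> y = 0"
proof -
  have 1: "y * Re a = x * Re b" "y * Im a = x * Im b"
    using assms(2) by (simp_all add: complex_eq_iff)
  have "y * Im (a * cnj b) = (y * Im a) * Re b - (y * Re a) * Im b" by (simp add: algebra_simps)
  also have "\<dots> = 0" unfolding 1 by simp
  finally have y: "y = 0" using assms(1) by (metis mult_eq_0_iff)
  have "x * Im (a * cnj b) = Im a * (x * Re b) - Re a * (x * Im b)" by (simp add: algebra_simps)
  also have "\<dots> = 0" unfolding 1[symmetric] by simp
  finally show ?thesis using y assms(1) by (metis mult_eq_0_iff)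
qed

text \<open>The first order \<open>n\<close> is arbitrary, so the types (2,3,3), (1,3,3) and (0,3,3)
  are treated together; the first component is the continuous function that must agree at two
  preimages of one planar value.\<close>

lemma reduced_double_top_order_not_injective:
  assumes red: "reduced_with_orders f (n, 3, 3)" and r: "r > 0"
  shows "\<not> inj_on f (punctured_disk r)"
proof
  assume inj: "inj_on f (punctured_disk r)"
  obtain \<phi> a b c h H where ce: "cubic_end f \<phi> a b c h H"
      and ord: "pole_order (\<lambda>z. \<phi> z $ 1) = n" "pole_order (\<lambda>z. \<phi> z $ 2) = 3" "pole_order (\<lambda>z. \<phi> z $ 3) = 3"
    by (rule reduced_cubic_end[OF red order_refl])
  note f = cubic_endD(1)[OF ce] and forms = cubic_endD(2)[OF ce] and H = cubic_endD(3)[OF ce]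
    and fk = cubic_endD(4)[OF ce]
  have D: "Im (a 2 * cnj (a 3)) \<noteq> 0" by (rule reduced_last_pair_independent[OF red f ord(1,3) forms])
  define D where "D = complex_of_real (Im (a 2 * cnj (a 3)))"
  have D0: "D \<noteq> 0" using D by (simp add: D_def del: times_complex.sel)
  have hol: "h k holomorphic_on ball 0 1" for k using forms[of k] by (simp add: cubic_pole_form_def)
  define g where "g k = cubic_potential 0 (b k) (c k) (H k)" for k
  have "\<exists>C\<ge>0. (\<forall>z\<in>punctured_disk (1/2). \<forall>z'\<in>punctured_disk (1/2). \<bar>g k z - g k z'\<bar> \<le> C * norm (1 / z - 1 / z')) \<and>
    (\<forall>z\<in>punctured_disk (1/2). \<bar>g k z\<bar> \<le> C / norm z)" for k
    unfolding g_def by (rule pole_potential_lipschitz_inverse[OF hol[of k] H[where k = k], where b = "b k" and c = "c k"]) blast+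
  then obtain C where C: "\<And>k. C k \<ge> 0"
      and glip: "\<And>k z z'. z \<in> punctured_disk (1/2) \<Longrightarrow> z' \<in> punctured_disk (1/2) \<Longrightarrow>
        \<bar>g k z - g k z'\<bar> \<le> C k * norm (1 / z - 1 / z')"
      and gbd: "\<And>k z. z \<in> punctured_disk (1/2) \<Longrightarrow> \<bar>g k z\<bar> \<le> C k / norm z"
    by metis
  \<comment> \<open>Recovers \<open>u\<close> from \<open>x = Re (a 2 * u)\<close> and
    \<open>y = Re (a 3 * u)\<close> and multiplies it by -2; the leading terms of the potentials
    have \<open>u = - 1 / (2 * z\<^sup>2)\<close>, which is thereby normalised to
    \<open>1 / z\<^sup>2\<close>.\<close>
  define T where "T x y = (-2 / D) * (\<i> * (of_real y * cnj (a 2) - of_real x * cnj (a 3)))" for x y :: real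
  have T_diff: "T x y - T x' y' = T (x - x') (y - y')" and T_add: "T (x + x') (y + y') = T x y + T x' y'"
    for x y x' y' by (simp_all add: T_def algebra_simps)
  have T_norm: "norm (T x y) \<le> 2 / norm D * (norm (a 2) + norm (a 3)) * (\<bar>x\<bar> + \<bar>y\<bar>)" for x y
  proof -
    have "norm (of_real y * cnj (a 2) - of_real x * cnj (a 3)) \<le> \<bar>y\<bar> * norm (a 2) + \<bar>x\<bar> * norm (a 3)"
      using norm_triangle_ineq4[of "of_real y * cnj (a 2)" "of_real x * cnj (a 3)"] by (simp add: norm_mult)
    also have "\<dots> \<le> (\<bar>x\<bar> + \<bar>y\<bar>) * norm (a 2) + (\<bar>x\<bar> + \<bar>y\<bar>) * norm (a 3)"
      by (intro add_mono mult_right_mono) auto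
    also have "\<dots> = (norm (a 2) + norm (a 3)) * (\<bar>x\<bar> + \<bar>y\<bar>)" by (simp add: algebra_simps)
    finally have "2 / norm D * norm (of_real y * cnj (a 2) - of_real x * cnj (a 3)) \<le>
        2 / norm D * ((norm (a 2) + norm (a 3)) * (\<bar>x\<bar> + \<bar>y\<bar>))"
      by (intro mult_left_mono) auto
    moreover have "norm (T x y) = 2 / norm D * norm (of_real y * cnj (a 2) - of_real x * cnj (a 3))"
      by (simp add: T_def norm_mult norm_divide)
    ultimately show ?thesis by (simp only: mult.assoc)
  qed
  define S where "S z = T (g 2 z) (g 3 z)" for z
  define M0 where "M0 = 2 / norm D * (norm (a 2) + norm (a 3))"
  define M where "M = M0 * (C 2 + C 3)"
  have M0: "M0 \<ge> 0" by (simp add: M0_def)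
  have M: "M \<ge> 0" unfolding M_def using M0 C by (intro mult_nonneg_nonneg add_nonneg_nonneg)
  have Sbd: "norm (S z) \<le> M / norm z" if z: "z \<in> punctured_disk (1/2)" for z
  proof -
    have "norm (S z) \<le> M0 * (\<bar>g 2 z\<bar> + \<bar>g 3 z\<bar>)" unfolding S_def M0_def by (rule T_norm)
    also have "\<dots> \<le> M0 * (C 2 / norm z + C 3 / norm z)"
      using M0 gbd[OF z] by (intro mult_left_mono add_mono)
    finally show ?thesis by (simp add: M_def add_divide_distrib distrib_left)
  qed
  have Slip: "norm (S z - S z') \<le> M * norm (1 / z - 1 / z')"
    if z: "z \<in> punctured_disk (1/2)" "z' \<in> punctured_disk (1/2)" for z z'
  proof -
    have "norm (S z - S z') \<le> M0 * (\<bar>g 2 z - g 2 z'\<bar> + \<bar>g 3 z - g 3 z'\<bar>)"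
      unfolding S_def T_diff M0_def by (rule T_norm)
    also have "\<dots> \<le> M0 * (C 2 * norm (1 / z - 1 / z') + C 3 * norm (1 / z - 1 / z'))"
      using M0 glip[OF z] by (intro mult_left_mono add_mono)
    also have "\<dots> = M * norm (1 / z - 1 / z')" by (simp only: M_def distrib_right mult.assoc)
    finally show ?thesis .
  qed
  have planar: "T (f z $ 2) (f z $ 3) = 1 / z\<^sup>2 + S z" if z: "z \<in> punctured_disk 1" for z
  proof -
    define u where "u = - 1 / (2 * z\<^sup>2)"
    have "f z $ k = Re (a k * u) + g k z" for k
      using fk[OF z, of k] by (simp add: g_def cubic_potential_def u_def)
    then have "T (f z $ 2) (f z $ 3) = T (Re (a 2 * u)) (Re (a 3 * u)) + S z"
      by (simp only: S_def T_add)
    also have "T (Re (a 2 * u)) (Re (a 3 * u)) = (-2 / D) * (D * u)"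
      unfolding T_def D_def real_parts_solve ..
    also have "\<dots> = 1 / z\<^sup>2" using D0 by (simp add: u_def)
    finally show ?thesis .
  qed
  \<comment> \<open>\<open>r\<close> may exceed 1, whereas the formulas for \<open>f\<close> hold in
    the punctured unit disk.\<close>
  have "min r 1 > 0" using r by simp
  then obtain z z' where z: "z \<in> punctured_disk (min r 1)" "z' \<in> punctured_disk (min r 1)" "z \<noteq> z'"
      "1 / z\<^sup>2 + S z = 1 / z'\<^sup>2 + S z'" "f z $ 1 = f z' $ 1"
    using double_cover_coincidence[OF M Sbd Slip end_continuous_on[OF f, of 1]] by blast
  have z1: "z \<in> punctured_disk 1" "z' \<in> punctured_disk 1" "z \<in> punctured_disk r" "z' \<in> punctured_disk r"
    using z by (auto simp: punctured_disk_iff)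
  have "T (f z $ 2 - f z' $ 2) (f z $ 3 - f z' $ 3) = 0"
    using planar[OF z1(1)] planar[OF z1(2)] z(4) T_diff by (metis diff_self)
  then have z0: "of_real (f z $ 3 - f z' $ 3) * cnj (a 2) - of_real (f z $ 2 - f z' $ 2) * cnj (a 3) = 0"
    using D0 by (simp add: T_def)
  have "f z $ 2 = f z' $ 2 \<and> f z $ 3 = f z' $ 3"
    using real_parts_injective[OF D z0] by simp
  then have "f z = f z'" using z(5) by (simp add: vec_eq_iff forall_3)
  then show False using inj z1 z(3) by (auto dest: inj_onD)
qed

section \<open>Examples\<close>

text \<open>Truncated Laurent expansions, whose constant term \<open>d $ k\<close> contributes
  \<open>Re (d $ k * z)\<close> to the end. The residues \<open>c\<close> are typed as real, so
  every choice of parameters integrates to an end.\<close>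

definition model_forms ::
    "complex ^ 3 \<Rightarrow> complex ^ 3 \<Rightarrow> real ^ 3 \<Rightarrow> complex ^ 3 \<Rightarrow> complex \<Rightarrow> complex ^ 3" where
  "model_forms a b c d z = (\<chi> k. a $ k / z ^ 3 + b $ k / z ^ 2 + of_real (c $ k) / z + d $ k)"

definition model_end ::
    "complex ^ 3 \<Rightarrow> complex ^ 3 \<Rightarrow> real ^ 3 \<Rightarrow> complex ^ 3 \<Rightarrow> complex \<Rightarrow> real ^ 3" where
  "model_end a b c d z = (\<chi> k. cubic_potential (a $ k) (b $ k) (c $ k) (\<lambda>z. d $ k * z) z)"

lemma model_forms_cubic:
  "cubic_pole_form (\<lambda>z. model_forms a b c d z $ k) (a $ k) (b $ k) (of_real (c $ k)) (\<lambda>z. d $ k)"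
  by (simp add: cubic_pole_form_def model_forms_def)

lemma model_end_with_forms: "end_with_forms (model_end a b c d) (model_forms a b c d)"
proof (rule cubic_end_with_formsI, intro exI conjI ballI)
  fix k z
  show "cubic_pole_form (\<lambda>z. model_forms a b c d z $ k) (a $ k) (b $ k) (of_real (c $ k)) (\<lambda>z. d $ k)"
    by (rule model_forms_cubic)
  show "((\<lambda>z. d $ k * z) has_field_derivative d $ k) (at z)"
    by (auto intro!: derivative_eq_intros)
  show "model_end a b c d z $ k = cubic_potential (a $ k) (b $ k) (c $ k) (\<lambda>z. d $ k * z) z"
    by (simp add: model_end_def)
qed

lemma model_combination_order:
  "pole_order (real_combination v (model_forms a b c d)) =
    (if of_real (v $ 1) * a $ 1 + of_real (v $ 2) * a $ 2 + of_real (v $ 3) * a $ 3 \<noteq> 0 then 3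
     else if of_real (v $ 1) * b $ 1 + of_real (v $ 2) * b $ 2 + of_real (v $ 3) * b $ 3 \<noteq> 0 then 2
     else if v $ 1 * c $ 1 + v $ 2 * c $ 2 + v $ 3 * c $ 3 \<noteq> 0 then 1 else 0)"
proof -
  have "of_real (v $ 1) * of_real (c $ 1) + of_real (v $ 2) * of_real (c $ 2) + of_real (v $ 3) * of_real (c $ 3)
      = complex_of_real (v $ 1 * c $ 1 + v $ 2 * c $ 2 + v $ 3 * c $ 3)"
    by simp
  then show ?thesis
    unfolding pole_order_cubic_pole_form[OF cubic_pole_form_combination[OF model_forms_cubic]]
    by (simp only: of_real_eq_0_iff)
qed

lemma vec3_neq_0_iff: "(v :: 'a::zero ^ 3) \<noteq> 0 \<longleftrightarrow> v $ 1 \<noteq> 0 \<or> v $ 2 \<noteq> 0 \<or> v $ 3 \<noteq> 0"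
  by (simp add: vec_eq_iff forall_3)

lemma proper_end_if_ln_component:
  assumes "\<And>z. z \<in> punctured_disk 1 \<Longrightarrow> f z $ k = ln (norm z)"
  shows "proper_end f"
proof -
  have "filterlim (\<lambda>x::real. - ln x) at_top (at_right 0)" by real_asymp
  then have "filterlim (\<lambda>z::complex. - ln (norm z)) at_top (at 0)"
    by (rule filterlim_compose[OF _ filterlim_norm_at_right_0])
  moreover have "eventually (\<lambda>z. - ln (norm z) \<le> norm (f z)) (at 0)"
    using eventually_punctured_disk[of 1]
  proof (rule eventually_mono)
    fix z :: complex assume "z \<in> punctured_disk 1"
    then show "- ln (norm z) \<le> norm (f z)"
      using assms[of z] component_le_norm_cart[of "f z" k] by simp
  qed simp
  ultimately show ?thesis unfolding proper_end_def by (rule filterlim_at_top_mono)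
qed

lemma cubic_potential_inverse:
  "cubic_potential a b c H z = Re (- a / 2 * (1 / z)\<^sup>2 - b * (1 / z) + H z) + c * ln (norm z)"
  by (simp add: cubic_potential_def power_divide)

lemma Re_square_inverse: "Re ((1 / z)\<^sup>2) = (Re (1 / z))\<^sup>2 - (Im (1 / z))\<^sup>2"
  by (simp only: Re_power2)

lemma norm_inverse_square: "(norm (1 / z))\<^sup>2 = (Re (1 / z))\<^sup>2 + (Im (1 / z))\<^sup>2"
  by (rule cmod_power2)

lemma Re_Im_inverse_norm: "Re (1 / z) = Re z / (norm z)\<^sup>2" "Im (1 / z) = - Im z / (norm z)\<^sup>2"
  by (simp_all add: Re_divide Im_divide cmod_power2)

lemma Re_ii_divide: "Re (\<i> / z) = - Im (1 / z)"
  by (simp add: Re_divide Im_divide)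

text \<open>With \<open>w = 1 / z\<close> the three ends below are \<open>(ln |z|, Re w, Re (w\<^sup>2) - Im w)\<close>,
  \<open>(- Im z, Re w, Re (w\<^sup>2))\<close> and \<open>(Re z, ln |z|, Re (w\<^sup>2) - Im w)\<close>. The leading coefficient of the
  last component is real on purpose: \<open>Re w\<close> and \<open>Re (w\<^sup>2)\<close> do not change under conjugation, so a
  lower order term has to recover the sign of \<open>Im w\<close>.\<close>

definition end_123 :: "complex \<Rightarrow> real ^ 3" where
  "end_123 = model_end (vector [0, 0, -2]) (vector [0, -1, -\<i>]) (vector [1, 0, 0]) 0"

definition end_023 :: "complex \<Rightarrow> real ^ 3" where
  "end_023 = model_end (vector [0, 0, -2]) (vector [0, -1, 0]) 0 (vector [\<i>, 0, 0])"

definition end_013 :: "complex \<Rightarrow> real ^ 3" where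
  "end_013 = model_end (vector [0, 0, -2]) (vector [0, 0, -\<i>]) (vector [0, 1, 0]) (vector [1, 0, 0])"

text \<open>The leading coefficients 1 and \<open>\<i>\<close> of the first two forms are
  independent over the reals, so this end is reduced; its embeddedness is an instance of the general
  result for type (2,2,3).\<close>

definition end_223 :: "complex \<Rightarrow> real ^ 3" where
  "end_223 = model_end (vector [0, 0, 1]) (vector [1, \<i>, 0]) 0 0"

lemma end_123_components:
  "end_123 z $ 1 = ln (norm z)" "end_123 z $ 2 = Re (1 / z)"
  "end_123 z $ 3 = (Re (1 / z))\<^sup>2 - (Im (1 / z))\<^sup>2 - Im (1 / z)"
  unfolding end_123_def model_end_def cubic_potential_inverse
  by (simp_all add: Re_square_inverse Re_ii_divide diff_divide_distrib del: Re_divide Im_divide)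

lemma end_023_components:
  "end_023 z $ 1 = - Im z" "end_023 z $ 2 = Re (1 / z)" "end_023 z $ 3 = (Re (1 / z))\<^sup>2 - (Im (1 / z))\<^sup>2"
  unfolding end_023_def model_end_def cubic_potential_inverse
  by (simp_all add: Re_square_inverse Re_ii_divide diff_divide_distrib del: Re_divide Im_divide)

lemma end_013_components:
  "end_013 z $ 1 = Re z" "end_013 z $ 2 = ln (norm z)"
  "end_013 z $ 3 = (Re (1 / z))\<^sup>2 - (Im (1 / z))\<^sup>2 - Im (1 / z)"
  unfolding end_013_def model_end_def cubic_potential_inverse
  by (simp_all add: Re_square_inverse Re_ii_divide diff_divide_distrib del: Re_divide Im_divide)

lemma end_223_reduced: "reduced_with_orders end_223 (2, 2, 3)"
  unfolding end_223_def
  by (rule reduced_with_ordersI[OF model_end_with_forms])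
    (auto simp: model_combination_order vec3_neq_0_iff complex_eq_iff)

lemma end_123_reduced: "reduced_with_orders end_123 (1, 2, 3)"
  unfolding end_123_def
  by (rule reduced_with_ordersI[OF model_end_with_forms])
    (auto simp: model_combination_order vec3_neq_0_iff complex_eq_iff)

lemma end_023_reduced: "reduced_with_orders end_023 (0, 2, 3)"
  unfolding end_023_def
  by (rule reduced_with_ordersI[OF model_end_with_forms])
    (auto simp: model_combination_order vec3_neq_0_iff complex_eq_iff)

lemma end_013_reduced: "reduced_with_orders end_013 (0, 1, 3)"
  unfolding end_013_def
  by (rule reduced_with_ordersI[OF model_end_with_forms])
    (auto simp: model_combination_order vec3_neq_0_iff complex_eq_iff)

lemma eq_if_inverse_parts_eq:
  assumes "Re (1 / z) = Re (1 / z')" "Im (1 / z) = Im (1 / z')"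
  shows "z = z'"
proof -
  have "1 / z = 1 / z'" using assms by (simp only: complex_eq_iff)
  then show ?thesis by simp
qed

text \<open>\<open>norm z\<close> and \<open>Re (1 / z)\<close> fix the square of
  \<open>Im (1 / z)\<close>; removing the squares from the last equation leaves
  \<open>Im (1 / z)\<close> itself.\<close>

lemma eq_if_norm_inverse_eq:
  assumes "norm z = norm z'" "Re (1 / z) = Re (1 / z')"
    "(Re (1 / z))\<^sup>2 - (Im (1 / z))\<^sup>2 - Im (1 / z) = (Re (1 / z'))\<^sup>2 - (Im (1 / z'))\<^sup>2 - Im (1 / z')"
  shows "z = z'"
proof -
  have "(norm (1 / z))\<^sup>2 = (norm (1 / z'))\<^sup>2" using assms(1) by (simp add: norm_divide)
  then have "(Im (1 / z))\<^sup>2 = (Im (1 / z'))\<^sup>2" unfolding norm_inverse_square assms(2) by simp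
  then have "Im (1 / z) = Im (1 / z')" using assms(3) unfolding assms(2) by simp
  then show ?thesis using assms(2) by (rule eq_if_inverse_parts_eq[rotated])
qed

lemma end_123_properly_embedded: "properly_embedded end_123"
proof -
  have "proper_end end_123" by (rule proper_end_if_ln_component) (rule end_123_components)
  moreover have "inj_on end_123 (punctured_disk 1)"
  proof (rule inj_onI)
    fix z z' assume z: "z \<in> punctured_disk 1" "z' \<in> punctured_disk 1" and eq: "end_123 z = end_123 z'"
    have "ln (norm z) = ln (norm z')" using eq end_123_components(1) by metis
    then have "norm z = norm z'" using z by (simp add: punctured_disk_iff)
    moreover have "Re (1 / z) = Re (1 / z')" using eq end_123_components(2) by metis
    moreover have "(Re (1 / z))\<^sup>2 - (Im (1 / z))\<^sup>2 - Im (1 / z) = (Re (1 / z'))\<^sup>2 - (Im (1 / z'))\<^sup>2 - Im (1 / z')"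
      using eq end_123_components(3) by metis
    ultimately show "z = z'" by (rule eq_if_norm_inverse_eq)
  qed
  moreover have "immersion_on end_123 (punctured_disk 1)"
    unfolding end_123_def
  proof (rule end_immersion_onI[OF model_end_with_forms order_refl])
    fix z h
    assume z: "z \<in> punctured_disk 1"
      and h: "\<And>k. Re (model_forms (vector [0, 0, -2]) (vector [0, -1, -\<i>]) (vector [1, 0, 0]) 0 z $ k * h) = 0"
    define w where "w = 1 / z"
    \<comment> \<open>The image of \<open>h\<close> under the differential of the complex logarithm.
      If it is nonzero, the first condition makes it imaginary, the second then makes
      \<open>w\<close> real, and the lower order term of the third forces
      \<open>w = 0\<close>.\<close>
    define q where "q = w * h"
    have w0: "w \<noteq> 0" using z by (simp add: w_def punctured_disk_iff)
    have zw: "a / z = a * w" "a / z ^ 2 = a * w ^ 2" "a / z ^ 3 = a * w ^ 3" for a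
      by (simp_all add: w_def power_divide)
    have 1: "Re q = 0" using h[of 1] by (simp add: model_forms_def zw q_def)
    have "Re (w ^ 2 * h) = 0"
      using h[of 2] by (simp add: model_forms_def zw del: times_complex.sel)
    then have 2: "Re (q * w) = 0"
      by (simp add: q_def power2_eq_square mult_ac del: times_complex.sel)
    have "Re ((- 2 * w ^ 3 - \<i> * w ^ 2) * h) = 0" using h[of 3] by (simp add: model_forms_def zw del: times_complex.sel)
    then have 3: "Re (- 2 * q * w * w - \<i> * q * w) = 0"
      by (simp add: q_def power2_eq_square power3_eq_cube algebra_simps del: times_complex.sel)
    have "q = 0"
    proof (rule ccontr)
      assume "q \<noteq> 0"
      then have "Im q \<noteq> 0" using 1 by (simp add: complex_eq_iff)
      then have "Im w = 0" using 2 1 by simp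
      then have "Re w = 0" using 3 1 \<open>Im q \<noteq> 0\<close> by simp
      then show False using w0 \<open>Im w = 0\<close> by (simp add: complex_eq_iff)
    qed
    then show "h = 0" using w0 by (simp add: q_def)
  qed
  ultimately show ?thesis unfolding properly_embedded_def by (intro conjI exI[of _ 1]) auto
qed

lemma end_013_properly_embedded: "properly_embedded end_013"
proof -
  have "proper_end end_013" by (rule proper_end_if_ln_component) (rule end_013_components)
  moreover have "inj_on end_013 (punctured_disk 1)"
  proof (rule inj_onI)
    fix z z' assume z: "z \<in> punctured_disk 1" "z' \<in> punctured_disk 1" and eq: "end_013 z = end_013 z'"
    have "ln (norm z) = ln (norm z')" using eq end_013_components(2) by metis
    then have n: "norm z = norm z'" using z by (simp add: punctured_disk_iff)
    have z0: "z \<noteq> 0" "z' \<noteq> 0" using z by (auto simp: punctured_disk_iff)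
    have "Re z = Re z'" using eq end_013_components(1) by metis
    then have "Re (1 / z) = Re (1 / z')"
      using n by (simp only: Re_Im_inverse_norm)
    moreover have "(Re (1 / z))\<^sup>2 - (Im (1 / z))\<^sup>2 - Im (1 / z) = (Re (1 / z'))\<^sup>2 - (Im (1 / z'))\<^sup>2 - Im (1 / z')"
      using eq end_013_components(3) by metis
    ultimately show "z = z'" by (rule eq_if_norm_inverse_eq[OF n])
  qed
  moreover have "immersion_on end_013 (punctured_disk 1)"
    unfolding end_013_def
  proof (rule end_immersion_onI[OF model_end_with_forms order_refl])
    fix z h
    assume z: "z \<in> punctured_disk 1"
      and h: "\<And>k. Re (model_forms (vector [0, 0, -2]) (vector [0, 0, -\<i>]) (vector [0, 1, 0]) (vector [1, 0, 0]) z $ k * h) = 0"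
    define w where "w = 1 / z"
    have w0: "w \<noteq> 0" using z by (simp add: w_def punctured_disk_iff)
    have zw: "a / z = a * w" "a / z ^ 2 = a * w ^ 2" "a / z ^ 3 = a * w ^ 3" for a
      by (simp_all add: w_def power_divide)
    have 1: "Re h = 0" using h[of 1] by (simp add: model_forms_def)
    have 2: "Re (h * w) = 0"
      using h[of 2] by (simp add: model_forms_def zw mult_ac del: times_complex.sel)
    have "Re ((- 2 * w ^ 3 - \<i> * w ^ 2) * h) = 0" using h[of 3] by (simp add: model_forms_def zw del: times_complex.sel)
    then have 3: "Re (- 2 * h * w * w * w - \<i> * h * w * w) = 0"
      by (simp add: power2_eq_square power3_eq_cube algebra_simps del: times_complex.sel)
    \<comment> \<open>A nonzero \<open>h\<close> is imaginary by the first condition, so the second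
      makes \<open>w\<close> real; the cubic term of the third is then imaginary, and its quadratic
      term gives \<open>w = 0\<close>.\<close>
    show "h = 0"
    proof (rule ccontr)
      assume "h \<noteq> 0"
      then have "Im h \<noteq> 0" using 1 by (simp add: complex_eq_iff)
      then have "Im w = 0" using 2 1 by simp
      then have "Re w = 0" using 3 1 \<open>Im h \<noteq> 0\<close> by simp
      then show False using w0 \<open>Im w = 0\<close> by (simp add: complex_eq_iff)
    qed
  qed
  ultimately show ?thesis unfolding properly_embedded_def by (intro conjI exI[of _ 1]) auto
qed

text \<open>No component is logarithmic, so properness is read off from
  \<open>(norm w)\<^sup>2 = 2 * (Re w)\<^sup>2 - Re (w\<^sup>2)\<close> with
  \<open>w = 1 / z\<close>. For injectivity the last two components give \<open>norm z\<close>,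
  after which \<open>Im z\<close> determines \<open>Im (1 / z)\<close>.\<close>

lemma end_023_properly_embedded: "properly_embedded end_023"
proof -
  have "proper_end end_023"
  proof -
    have lower: "(1 / norm z - 1) / 2 \<le> norm (end_023 z)" for z
    proof -
      let ?N = "norm (end_023 z)"
      have 2: "\<bar>Re (1 / z)\<bar> \<le> ?N" and 3: "\<bar>(Re (1 / z))\<^sup>2 - (Im (1 / z))\<^sup>2\<bar> \<le> ?N"
        using component_le_norm_cart[of "end_023 z" 2] component_le_norm_cart[of "end_023 z" 3]
        unfolding end_023_components .
      have "(1 / norm z)\<^sup>2 = 2 * (Re (1 / z))\<^sup>2 - ((Re (1 / z))\<^sup>2 - (Im (1 / z))\<^sup>2)"
        using norm_inverse_square[of z] by (simp add: norm_divide del: Re_divide Im_divide)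
      also have "\<dots> \<le> 2 * ?N\<^sup>2 + ?N"
        using 3 abs_le_square_iff[of "Re (1 / z)" ?N] 2 by auto
      also have "\<dots> \<le> (2 * ?N + 1)\<^sup>2" by (simp add: power2_eq_square algebra_simps)
      finally have "1 / norm z \<le> 2 * ?N + 1" by (rule power2_le_imp_le) simp
      then show ?thesis by simp
    qed
    have "filterlim (\<lambda>x::real. (1 / x - 1) / 2) at_top (at_right 0)" by real_asymp
    then have "filterlim (\<lambda>z::complex. (1 / norm z - 1) / 2) at_top (at 0)"
      by (rule filterlim_compose[OF _ filterlim_norm_at_right_0])
    then show ?thesis
      unfolding proper_end_def by (rule filterlim_at_top_mono) (use lower in \<open>auto intro: always_eventually\<close>)
  qed
  moreover have "inj_on end_023 (punctured_disk 1)"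
  proof (rule inj_onI)
    fix z z' assume z: "z \<in> punctured_disk 1" "z' \<in> punctured_disk 1" and eq: "end_023 z = end_023 z'"
    have z0: "z \<noteq> 0" "z' \<noteq> 0" using z by (auto simp: punctured_disk_iff)
    have re: "Re (1 / z) = Re (1 / z')" using eq end_023_components(2) by metis
    have "(Re (1 / z))\<^sup>2 - (Im (1 / z))\<^sup>2 = (Re (1 / z'))\<^sup>2 - (Im (1 / z'))\<^sup>2"
      using eq end_023_components(3) by metis
    then have "(norm (1 / z))\<^sup>2 = (norm (1 / z'))\<^sup>2" unfolding norm_inverse_square re by simp
    then have "norm z = norm z'" using z0 by (simp add: norm_divide power_divide)
    moreover have "Im z = Im z'" using eq end_023_components(1) by (metis neg_equal_iff_equal)
    ultimately have "Im (1 / z) = Im (1 / z')" by (simp only: Re_Im_inverse_norm)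
    with re show "z = z'" by (rule eq_if_inverse_parts_eq)
  qed
  moreover have "immersion_on end_023 (punctured_disk 1)"
    unfolding end_023_def
  proof (rule end_immersion_onI[OF model_end_with_forms order_refl])
    fix z h
    assume z: "z \<in> punctured_disk 1"
      and h: "\<And>k. Re (model_forms (vector [0, 0, -2]) (vector [0, -1, 0]) 0 (vector [\<i>, 0, 0]) z $ k * h) = 0"
    define w where "w = 1 / z"
    have w0: "w \<noteq> 0" using z by (simp add: w_def punctured_disk_iff)
    have zw: "a / z = a * w" "a / z ^ 2 = a * w ^ 2" "a / z ^ 3 = a * w ^ 3" for a
      by (simp_all add: w_def power_divide)
    have 1: "Im h = 0" using h[of 1] by (simp add: model_forms_def)
    have 2: "Re (w ^ 2 * h) = 0"
      using h[of 2] by (simp add: model_forms_def zw del: times_complex.sel)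
    have "Re (- 2 * w ^ 3 * h) = 0"
      using h[of 3] by (simp add: model_forms_def zw del: times_complex.sel)
    moreover have "- 2 * w ^ 3 * h = of_real (- 2) * (w * w ^ 2 * h)"
      by (simp add: power2_eq_square power3_eq_cube)
    ultimately have "- 2 * Re (w * w ^ 2 * h) = 0" by (metis scaleR_complex.sel(1) scaleR_conv_of_real)
    then have 3: "Re (w * w ^ 2 * h) = 0" by simp
    \<comment> \<open>A nonzero \<open>h\<close> is real by the first condition, so
      \<open>Re (w ^ 2) = 0\<close> and \<open>Re (w ^ 3) = 0\<close>, whose only common solution is
      \<open>w = 0\<close>.\<close>
    show "h = 0"
    proof (rule ccontr)
      assume "h \<noteq> 0"
      then have hr: "Re h \<noteq> 0" using 1 by (simp add: complex_eq_iff)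
      then have w2: "Re (w ^ 2) = 0" using 2 1 by simp
      then have "Im w * Im (w ^ 2) = 0" using 3 1 hr by simp
      then have "Im w * (Re w * Im w) = 0" by (simp add: Im_power2)
      then have "Re w = 0 \<or> Im w = 0" by auto
      then show False using w2 w0 by (auto simp: Re_power2 complex_eq_iff)
    qed
  qed
  ultimately show ?thesis unfolding properly_embedded_def by (intro conjI exI[of _ 1]) auto
qed

lemma reduced_has_type: "reduced_with_orders f n \<Longrightarrow> has_type f n"
  unfolding has_type_def using affinely_equivalent_refl by blast

lemma reduced_meromorphic_end: "reduced_with_orders f n \<Longrightarrow> meromorphic_end f"
  unfolding reduced_with_orders_def has_pole_orders_def meromorphic_end_def by blast

lemma top_pair_not_properly_embedded:
  assumes "has_type f (n, 3, 3)"
  shows "\<not> properly_embedded f"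
  using assms reduced_double_top_order_not_injective properly_embedded_affine
  unfolding has_type_def properly_embedded_def by blast

lemma type_003_not_properly_embedded:
  assumes "has_type f (0, 0, 3)"
  shows "\<not> properly_embedded f"
  using assms reduced_003_not_proper properly_embedded_affine
  unfolding has_type_def properly_embedded_def by blast

theorem theorem2p10:
  "(\<forall>f. meromorphic_end f \<and> has_type f (2,2,3) \<longrightarrow> properly_embedded f) \<and>
   (\<forall>t \<in> {(2,2,3), (1,2,3), (0,2,3), (0,1,3)}.
      \<exists>f. meromorphic_end f \<and> reduced_with_orders f t \<and> has_type f t \<and> properly_embedded f) \<and>
   (\<forall>f. meromorphic_end f \<and> has_order f 3 \<and>
        (\<forall>t \<in> {(2,2,3), (1,2,3), (0,2,3), (0,1,3)}. \<not> has_type f t) \<longrightarrow>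
        (\<exists>t \<in> {(2,3,3), (1,3,3), (0,3,3), (0,0,3)}. has_type f t)) \<and>
   (\<forall>f. \<forall>t \<in> {(2,3,3), (1,3,3), (0,3,3), (0,0,3)}.
        meromorphic_end f \<and> has_type f t \<longrightarrow> \<not> properly_embedded f)"
proof (intro conjI allI impI)
  \<comment> \<open>The reduced representative is embedded; symmetry of affine equivalence carries
    this back to \<open>f\<close>.\<close>
  show "properly_embedded f" if "meromorphic_end f \<and> has_type f (2, 2, 3)" for f
    using that reduced_223_properly_embedded properly_embedded_affine affinely_equivalent_sym
    unfolding has_type_def by blast
  have "\<exists>f. meromorphic_end f \<and> reduced_with_orders f t \<and> has_type f t \<and> properly_embedded f"
    if "reduced_with_orders g t" "properly_embedded g" for g t
    using that reduced_has_type reduced_meromorphic_end by blast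
  then show "\<forall>t \<in> {(2,2,3), (1,2,3), (0,2,3), (0,1,3)}.
      \<exists>f. meromorphic_end f \<and> reduced_with_orders f t \<and> has_type f t \<and> properly_embedded f"
    using end_223_reduced reduced_223_properly_embedded end_123_reduced end_123_properly_embedded
      end_023_reduced end_023_properly_embedded end_013_reduced end_013_properly_embedded
    by (metis empty_iff insert_iff)
  show "\<exists>t \<in> {(2,3,3), (1,3,3), (0,3,3), (0,0,3)}. has_type f t"
    if "meromorphic_end f \<and> has_order f 3 \<and>
        (\<forall>t \<in> {(2,2,3), (1,2,3), (0,2,3), (0,1,3)}. \<not> has_type f t)" for f
    using that has_order_3_types[of f] by blast
  show "\<forall>t \<in> {(2,3,3), (1,3,3), (0,3,3), (0,0,3)}.
      meromorphic_end f \<and> has_type f t \<longrightarrow> \<not> properly_embedded f" for f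
    using top_pair_not_properly_embedded type_003_not_properly_embedded by blast
qed

end
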